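(* Let $R$ be a reduced root system in a finite-dimensional Euclidean space $V$ with positive system $R_+$, let $k$ be a multiplicity function, and let $X$ be the associated Dunkl process. Let $R^i$ be a conjugacy class ($W$-orbit) of $R$, $R_+^i:=R^i\cap R_+$, and let $k_i$ be the value of $k$ on $R^i$. For $\alpha\in R_+$ and $t\ge0$ set $$N_t^\alpha:=\sum_{s\le t}\mathbf{1}_{\{X_s=\sigma_\alpha X_{s-}\neq X_{s-}\}}.$$ If $k_i>1/2$, then for any $\alpha\in R_+^i$, any $x\notin\bigcup_{\beta\in R^i}H_\beta$ and any $t\ge 0$, one has $\mathbb{E}_x[N_t^\alpha]<\infty$.
   Context: $(V,\langle\cdot,\cdot\rangle)$ is a Euclidean space of finite dimension $m$, $|\alpha|^2=\langle\alpha,\alpha\rangle$. For $\alpha\neq 0$, $H_\alpha$ is the hyperplane orthogonal to $\alpha$ and $\sigma_\alpha(x)=x-2\frac{\langle\alpha,x\rangle}{|\alpha|^2}\alpha$. A reduced root system $R$ is a finite set of nonzero vectors of $V$ such that $R\cap\mathbb{R}\alpha=\{\alpha,-\alpha\}$ and $\sigma_\alpha(R)=R$ for all $\alpha\in R$. A simple system $S\subset R$ is a basis of $\mathrm{span}(R)$ such that every root is a linear combination of elements of $S$ with coefficients all of the same sign; the positive system $R_+$ is the set of roots that are nonnegative combinations of elements of $S$. $W$ is the finite group generated by the $\sigma_\alpha$, $\alpha\in R$. A multiplicity function is a $W$-invariant function $k:R\to[0,\infty)$; it is constant on each $W$-orbit of $R$. The Dunkl process $X$ associated with $(R,k)$ is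 the $V$-valued càdlàg Markov process with semigroup density (with respect to Lebesgue measure $dy$ on $V$) $$p_t^k(x,y)=\frac{1}{c_k t^{\gamma+m/2}}e^{-(|x|^2+|y|^2)/(2t)}D_k\!\left(\frac{x}{\sqrt t},\frac{y}{\sqrt t}\right)\omega_k(y),\quad \gamma=\sum_{\alpha\in R_+}k(\alpha),\quad \omega_k(y)=\prod_{\alpha\in R_+}|\langle\alpha,y\rangle|^{2k(\alpha)},$$ where $c_k=\int_V e^{-|y|^2/2}\omega_k(y)\,dy$ and $D_k$ is the Dunkl kernel: for each $y$, $D_k(\cdot,y)$ is the unique smooth function $f$ with $f(0)=1$ and $T_\xi f=\langle\xi,y\rangle f$ for all $\xi\in V$, with Dunkl operators $T_\xi f(x)=\partial_\xi f(x)+\sum_{\alpha\in R_+}k(\alpha)\langle\alpha,\xi\rangle\frac{f(x)-f(\sigma_\alpha x)}{\langle\alpha,x\rangle}$. Its generator is $\frac12\sum_{i=1}^m T_{e_i}^2$ for an orthonormal basis $(e_i)$ of $V$. $\mathbb{E}_x$ denotes expectation when $X_0=x$. *)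

theory Defs
  imports "HOL-Probability.Probability"
begin

section \<open>Root systems\<close>

definition hyperplane :: "'a::euclidean_space \<Rightarrow> 'a set" where
  "hyperplane \<alpha> = {x. \<alpha> \<bullet> x = 0}"

definition reflection :: "'a::euclidean_space \<Rightarrow> 'a \<Rightarrow> 'a" where
  "reflection \<alpha> x = x - (2 * (\<alpha> \<bullet> x) / (norm \<alpha>)\<^sup>2) *\<^sub>R \<alpha>"

definition reduced_root_system :: "'a::euclidean_space set \<Rightarrow> bool" where
  "reduced_root_system R \<longleftrightarrow>
     finite R \<and> 0 \<notin> R \<and>
     (\<forall>\<alpha>\<in>R. R \<inter> range (\<lambda>c. c *\<^sub>R \<alpha>) = {\<alpha>, - \<alpha>}) \<and>
     (\<forall>\<alpha>\<in>R. reflection \<alpha> ` R = R)"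

definition simple_system :: "'a::euclidean_space set \<Rightarrow> 'a set \<Rightarrow> bool" where
  "simple_system R S \<longleftrightarrow>
     S \<subseteq> R \<and> independent S \<and> span S = span R \<and>
     (\<forall>\<beta>\<in>R. \<exists>c. \<beta> = (\<Sum>\<alpha>\<in>S. c \<alpha> *\<^sub>R \<alpha>) \<and>
        ((\<forall>\<alpha>\<in>S. 0 \<le> c \<alpha>) \<or> (\<forall>\<alpha>\<in>S. c \<alpha> \<le> 0)))"

definition positive_system :: "'a::euclidean_space set \<Rightarrow> 'a set \<Rightarrow> 'a set" where
  "positive_system R S =
     {\<beta>\<in>R. \<exists>c. \<beta> = (\<Sum>\<alpha>\<in>S. c \<alpha> *\<^sub>R \<alpha>) \<and> (\<forall>\<alpha>\<in>S. 0 \<le> c \<alpha>)}"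

inductive_set weyl_group :: "('a::euclidean_space) set \<Rightarrow> ('a \<Rightarrow> 'a) set"
  for R :: "'a set" where
  weyl_id: "id \<in> weyl_group R"
| weyl_reflection: "\<alpha> \<in> R \<Longrightarrow> reflection \<alpha> \<in> weyl_group R"
| weyl_comp: "v \<in> weyl_group R \<Longrightarrow> w \<in> weyl_group R \<Longrightarrow> v \<circ> w \<in> weyl_group R"
| weyl_inv: "w \<in> weyl_group R \<Longrightarrow> inv w \<in> weyl_group R"

definition weyl_orbit :: "'a::euclidean_space set \<Rightarrow> 'a \<Rightarrow> 'a set" where
  "weyl_orbit R \<alpha> = (\<lambda>w. w \<alpha>) ` weyl_group R"

definition multiplicity_function :: "'a::euclidean_space set \<Rightarrow> ('a \<Rightarrow> real) \<Rightarrow> bool" where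
  "multiplicity_function R k \<longleftrightarrow>
     (\<forall>\<alpha>\<in>R. 0 \<le> k \<alpha>) \<and> (\<forall>w\<in>weyl_group R. \<forall>\<alpha>\<in>R. k (w \<alpha>) = k \<alpha>)"


section \<open>Dunkl operators and the Dunkl kernel\<close>

text \<open>The functions all of whose iterated directional derivatives up to order \<open>n\<close>
  exist and are continuous.\<close>

primrec cont_diff :: "nat \<Rightarrow> ('a::euclidean_space \<Rightarrow> real) \<Rightarrow> bool" where
  "cont_diff 0 f \<longleftrightarrow> continuous_on UNIV f"
| "cont_diff (Suc n) f \<longleftrightarrow>
     (\<forall>x. f differentiable (at x)) \<and> (\<forall>v. cont_diff n (\<lambda>x. frechet_derivative f (at x) v))"

definition smooth :: "('a::euclidean_space \<Rightarrow> real) \<Rightarrow> bool" where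
  "smooth f \<longleftrightarrow> (\<forall>n. cont_diff n f)"

text \<open>For smooth \<open>f\<close> the difference quotient has a removable singularity along the
  hyperplane orthogonal to \<open>\<alpha>\<close>; there it denotes the continuous extension.\<close>

definition dunkl_quotient :: "'a::euclidean_space \<Rightarrow> ('a \<Rightarrow> real) \<Rightarrow> 'a \<Rightarrow> real" where
  "dunkl_quotient \<alpha> f x =
     (if x \<in> hyperplane \<alpha>
      then Lim (at x within - hyperplane \<alpha>) (\<lambda>z. (f z - f (reflection \<alpha> z)) / (\<alpha> \<bullet> z))
      else (f x - f (reflection \<alpha> x)) / (\<alpha> \<bullet> x))"

definition dunkl_operator ::
  "'a::euclidean_space set \<Rightarrow> ('a \<Rightarrow> real) \<Rightarrow> 'a \<Rightarrow> ('a \<Rightarrow> real) \<Rightarrow> 'a \<Rightarrow> real" where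
  "dunkl_operator Rp k \<xi> f x =
     frechet_derivative f (at x) \<xi> + (\<Sum>\<alpha>\<in>Rp. k \<alpha> * (\<alpha> \<bullet> \<xi>) * dunkl_quotient \<alpha> f x)"

text \<open>\<open>D\<close> is the Dunkl kernel if, for each \<open>y\<close>, \<open>D \<sqdot> y\<close> is the unique normalised smooth joint
  eigenfunction of the Dunkl operators with eigenvalues \<open>\<xi> \<bullet> y\<close>.\<close>

definition dunkl_kernel ::
  "'a::euclidean_space set \<Rightarrow> ('a \<Rightarrow> real) \<Rightarrow> ('a \<Rightarrow> 'a \<Rightarrow> real) \<Rightarrow> bool" where
  "dunkl_kernel Rp k D \<longleftrightarrow>
     (\<forall>y f. (smooth f \<and> f 0 = 1 \<and> (\<forall>\<xi> x. dunkl_operator Rp k \<xi> f x = (\<xi> \<bullet> y) * f x))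
            \<longleftrightarrow> f = (\<lambda>x. D x y))"


section \<open>The Dunkl semigroup and the Dunkl process\<close>

definition dunkl_gamma :: "'a::euclidean_space set \<Rightarrow> ('a \<Rightarrow> real) \<Rightarrow> real" where
  "dunkl_gamma Rp k = (\<Sum>\<alpha>\<in>Rp. k \<alpha>)"

text \<open>Since \<open>0 powr 0 = 0\<close>, the weight vanishes on the hyperplanes of roots with
  \<open>k \<alpha> = 0\<close>. This is a Lebesgue null set, and the weight is only ever used as (a factor of) a
  density with respect to Lebesgue measure.\<close>

definition dunkl_weight :: "'a::euclidean_space set \<Rightarrow> ('a \<Rightarrow> real) \<Rightarrow> 'a \<Rightarrow> real" where
  "dunkl_weight Rp k y = (\<Prod>\<alpha>\<in>Rp. \<bar>\<alpha> \<bullet> y\<bar> powr (2 * k \<alpha>))"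

definition dunkl_const :: "'a::euclidean_space set \<Rightarrow> ('a \<Rightarrow> real) \<Rightarrow> real" where
  "dunkl_const Rp k = (LINT y|lborel. exp (- (norm y)\<^sup>2 / 2) * dunkl_weight Rp k y)"

definition dunkl_density ::
  "'a::euclidean_space set \<Rightarrow> ('a \<Rightarrow> real) \<Rightarrow> ('a \<Rightarrow> 'a \<Rightarrow> real) \<Rightarrow> real \<Rightarrow> 'a \<Rightarrow> 'a \<Rightarrow> real" where
  "dunkl_density Rp k D t x y =
     1 / (dunkl_const Rp k * t powr (dunkl_gamma Rp k + real DIM('a) / 2))
     * exp (- ((norm x)\<^sup>2 + (norm y)\<^sup>2) / (2 * t))
     * D (x /\<^sub>R sqrt t) (y /\<^sub>R sqrt t) * dunkl_weight Rp k y"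

definition cadlag :: "(real \<Rightarrow> 'a::topological_space) \<Rightarrow> bool" where
  "cadlag g \<longleftrightarrow>
     (\<forall>t\<ge>0. (g \<longlongrightarrow> g t) (at_right t)) \<and> (\<forall>t>0. \<exists>l. (g \<longlongrightarrow> l) (at_left t))"

definition natural_filtration ::
  "'w measure \<Rightarrow> (real \<Rightarrow> 'w \<Rightarrow> 'a::topological_space) \<Rightarrow> real \<Rightarrow> 'w measure" where
  "natural_filtration M X s =
     sigma (space M) (\<Union>u\<in>{0..s}. {X u -` A \<inter> space M | A. A \<in> sets borel})"

text \<open>A Markov process with transition densities \<open>p\<close>, indexed by the times \<open>t \<ge> 0\<close>; the
  values \<open>X t\<close> for \<open>t < 0\<close> play no role. The Markov property is required with respect to the
  natural filtration, which is the weakest choice.\<close>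

definition markov_process_with_density ::
  "'w measure \<Rightarrow> (real \<Rightarrow> 'w \<Rightarrow> 'a::euclidean_space) \<Rightarrow> (real \<Rightarrow> 'a \<Rightarrow> 'a \<Rightarrow> real) \<Rightarrow> bool" where
  "markov_process_with_density M X p \<longleftrightarrow>
     (\<forall>t\<ge>0. X t \<in> borel_measurable M) \<and>
     (\<forall>s\<ge>0. \<forall>t>0. \<forall>A\<in>sets borel.
        AE \<omega> in M. real_cond_exp M (natural_filtration M X s) (\<lambda>\<omega>. indicator A (X (s + t) \<omega>)) \<omega>
                   = (LINT y:A|lborel. p t (X s \<omega>) y))"

definition dunkl_process ::
  "'a::euclidean_space set \<Rightarrow> ('a \<Rightarrow> real) \<Rightarrow> ('a \<Rightarrow> 'a \<Rightarrow> real) \<Rightarrow>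
   'w measure \<Rightarrow> (real \<Rightarrow> 'w \<Rightarrow> 'a) \<Rightarrow> bool" where
  "dunkl_process Rp k D M X \<longleftrightarrow>
     (\<forall>\<omega>\<in>space M. cadlag (\<lambda>t. X t \<omega>)) \<and>
     markov_process_with_density M X (dunkl_density Rp k D)"


section \<open>Counting jumps\<close>

definition left_limit :: "(real \<Rightarrow> 'a::t2_space) \<Rightarrow> real \<Rightarrow> 'a" where
  "left_limit g s = Lim (at_left s) g"

text \<open>With the convention \<open>X\<^sub>0\<^sub>- = X\<^sub>0\<close> there is no jump at time \<open>0\<close>, so the sum runs over
  \<open>0 < s \<le> t\<close>. It is taken in \<open>[0, \<infinity>]\<close>.\<close>

definition jump_count :: "(real \<Rightarrow> 'w \<Rightarrow> 'a::euclidean_space) \<Rightarrow> 'a \<Rightarrow> real \<Rightarrow> 'w \<Rightarrow> ennreal" where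
  "jump_count X \<alpha> t \<omega> =
     (\<Sum>\<^sub>\<infinity>s\<in>{0<..t}.
        of_bool (X s \<omega> = reflection \<alpha> (left_limit (\<lambda>u. X u \<omega>) s) \<and>
                 X s \<omega> \<noteq> left_limit (\<lambda>u. X u \<omega>) s))"

end

theory Submission
  imports Defs
begin

text \<open>
  Let \<open>q = \<gamma> + m/2\<close> and let \<open>\<alpha>\<close> be the root whose reflection jumps are counted. A jump from
  \<open>z\<close> to \<open>\<sigma>\<^sub>\<alpha> z \<noteq> z\<close> changes the sign of \<open>\<langle>\<alpha>, X\<rangle>\<close>. Hence the number of jumps up to time \<open>t\<close> is at
  most the lower limit, as \<open>n \<rightarrow> \<infinity>\<close>, of the number of sign changes of \<open>\<langle>\<alpha>, X\<rangle>\<close> along the grid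
  \<open>i t / n\<close> (\<open>jump_count_le_liminf\<close>), and by Fatou it suffices to bound the expected number of
  these sign changes uniformly in \<open>n\<close>. Two estimates do this.

  First, \<open>E\<^sub>z |X\<^sub>h - z|\<^sup>2 \<le> 2 q h\<close> for every \<open>z\<close> (\<open>density_second_moment\<close>). A change of sign forces
  \<open>|\<langle>\<alpha>, X\<^sub>h - z\<rangle>| \<ge> |\<langle>\<alpha>, z\<rangle>|\<close>, so by Chebyshev it has probability at most
  \<open>2 q |\<alpha>|\<^sup>2 h / \<langle>\<alpha>, z\<rangle>\<^sup>2\<close>; this is where the singularity \<open>\<langle>\<alpha>, z\<rangle>\<^sup>-\<^sup>2\<close> of the jump rate shows up.

  Second, \<open>E\<^sub>x \<langle>\<alpha>, X\<^sub>s\<rangle>\<^sup>-\<^sup>2\<close> is bounded for \<open>0 < s \<le> t\<close> (\<open>inverse_square_bounded\<close>). The density of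
  \<open>X\<^sub>s\<close> at \<open>y\<close> is at most a constant times \<open>s\<^sup>-\<^sup>q exp (- |u - y|\<^sup>2 / (2 s)) \<omega>\<^sub>k(y)\<close> for some image \<open>u\<close> of
  the initial point \<open>x\<close>. As \<open>x\<close> lies on no hyperplane of the orbit of \<open>\<alpha>\<close>, no image of \<open>x\<close> lies on
  the hyperplane of \<open>\<alpha>\<close>; near that hyperplane the Gaussian factor absorbs \<open>s\<^sup>-\<^sup>q\<close>, and
  \<open>\<omega>\<^sub>k(y) / \<langle>\<alpha>, y\<rangle>\<^sup>2\<close> is locally integrable because \<open>2 k(\<alpha>) - 2 > -1\<close>.

  Everything about the Dunkl kernel comes from its eigenvalue equation in the direction \<open>\<xi> = x\<close>. Along
  rays, the values of \<open>D(\<cdot>, y)\<close> at the finitely many images of a point solve a linear system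
  whose off-diagonal entries are nonnegative. A maximum principle for such systems
  (\<open>radial_max_principle\<close>) yields positivity, the bound \<open>D(x, y) \<le> exp (max \<langle>u, y\<rangle>)\<close> over the images \<open>u\<close>
  of \<open>x\<close>, and the homogeneity \<open>D(c x, y) = D(x, c y)\<close>. The Markov property,
  applied to the whole space, shows that the transition densities have total mass one from almost every
  starting point, and then from every one by continuity. Differentiation of the resulting identity
  \<open>\<integral> exp (- |y|\<^sup>2 / (2 t)) D(x, y) \<omega>\<^sub>k(y) dy = c\<^sub>k t\<^sup>q exp (t |x|\<^sup>2 / 2)\<close> in \<open>t\<close> and along the ray of \<open>x\<close>
  produces the two moments needed for the first estimate.
\<close>

section \<open>Images of a point under reflections\<close>

lemma reflection_inner: "reflection \<beta> u \<bullet> v = u \<bullet> reflection \<beta> v"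
  by (simp add: reflection_def inner_diff_left inner_diff_right inner_commute)

lemma reflection_reflection: "reflection \<beta> (reflection \<beta> u) = u"
proof (cases "\<beta> = 0")
  case False
  then have "\<beta> \<bullet> \<beta> \<noteq> 0" by simp
  then have "\<beta> \<bullet> reflection \<beta> u = - (\<beta> \<bullet> u)"
    by (simp add: reflection_def inner_diff_right power2_norm_eq_inner)
  then show ?thesis by (simp add: reflection_def)
qed (simp add: reflection_def)

lemma norm_reflection [simp]: "norm (reflection \<beta> u) = norm u"
  by (simp add: norm_eq_sqrt_inner reflection_inner reflection_reflection)

lemma reflection_scaleR: "reflection \<beta> (r *\<^sub>R u) = r *\<^sub>R reflection \<beta> u"
  by (simp add: reflection_def algebra_simps)

text \<open>The orbit of \<open>x\<close> under the reflection group, generated from \<open>x\<close> so that invariants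
  follow by rule induction.\<close>

inductive_set mirror_images :: "'a::euclidean_space set \<Rightarrow> 'a \<Rightarrow> 'a set"
  for R :: "'a set" and x :: 'a where
  start: "x \<in> mirror_images R x"
| reflect: "u \<in> mirror_images R x \<Longrightarrow> \<beta> \<in> R \<Longrightarrow> reflection \<beta> u \<in> mirror_images R x"

lemma norm_mirror_images: "u \<in> mirror_images R x \<Longrightarrow> norm u = norm x"
  by (induction rule: mirror_images.induct) auto

lemma inner_mirror_images:
  assumes "u \<in> mirror_images R x" and "\<And>\<beta>. \<beta> \<in> R \<Longrightarrow> reflection \<beta> ` Q \<subseteq> Q" and "\<gamma> \<in> Q"
  shows "\<exists>\<delta>\<in>Q. \<gamma> \<bullet> u = \<delta> \<bullet> x"
  using assms(1,3)
proof (induction arbitrary: \<gamma> rule: mirror_images.induct)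
  case start
  then show ?case by auto
next
  case (reflect u \<beta>)
  have "reflection \<beta> \<gamma> \<in> Q" using assms(2) reflect by blast
  then show ?case using reflect.IH[of "reflection \<beta> \<gamma>"] by (simp add: reflection_inner)
qed

lemma mirror_images_diff_span: "u \<in> mirror_images R x \<Longrightarrow> u - x \<in> span R"
proof (induction rule: mirror_images.induct)
  case (reflect u \<beta>)
  have "(u - x) - (2 * (\<beta> \<bullet> u) / (norm \<beta>)\<^sup>2) *\<^sub>R \<beta> \<in> span R"
    using reflect by (intro span_diff[OF reflect.IH] span_scale) (auto intro: span_base)
  moreover have "reflection \<beta> u - x = (u - x) - (2 * (\<beta> \<bullet> u) / (norm \<beta>)\<^sup>2) *\<^sub>R \<beta>"
    by (simp add: reflection_def)
  ultimately show ?case by metis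
qed (simp add: span_zero)

text \<open>An image \<open>u\<close> of \<open>x\<close> differs from \<open>x\<close> by an element of the span of \<open>R\<close>, so it is determined by its inner
  products with \<open>R\<close>, and these take values in the finite set of inner products of \<open>x\<close> with \<open>R\<close>.\<close>

lemma finite_mirror_images:
  assumes "finite R" and closed: "\<And>\<beta>. \<beta> \<in> R \<Longrightarrow> reflection \<beta> ` R \<subseteq> R"
  shows "finite (mirror_images R x)"
proof -
  let ?f = "\<lambda>u. \<lambda>\<gamma>\<in>R. \<gamma> \<bullet> u"
  have "inj_on ?f (mirror_images R x)"
  proof (rule inj_onI)
    fix u v assume u: "u \<in> mirror_images R x" and v: "v \<in> mirror_images R x" and eq: "?f u = ?f v"
    have "(u - x) - (v - x) \<in> span R" by (intro span_diff mirror_images_diff_span u v)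
    then have sp: "u - v \<in> span R" by simp
    have "orthogonal (u - v) \<gamma>" if "\<gamma> \<in> R" for \<gamma>
      using fun_cong[OF eq, of \<gamma>] that by (simp add: orthogonal_def inner_diff_right inner_commute)
    then have "orthogonal (u - v) (u - v)" using orthogonal_to_span[OF sp] by blast
    then show "u = v" by (simp add: orthogonal_def)
  qed
  moreover have "?f ` mirror_images R x \<subseteq> (\<Pi>\<^sub>E \<gamma>\<in>R. (\<lambda>\<delta>. \<delta> \<bullet> x) ` R)"
    using inner_mirror_images[OF _ closed] by (fastforce simp: PiE_iff)
  moreover have "finite (\<Pi>\<^sub>E \<gamma>\<in>R. (\<lambda>\<delta>. \<delta> \<bullet> x) ` R)"
    using assms(1) by (intro finite_PiE) auto
  ultimately show ?thesis by (meson finite_imageD finite_subset)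
qed

section \<open>A maximum principle for the radial Dunkl system\<close>

text \<open>After damping by \<open>exp (- A r)\<close>, a positive maximum over all components and all radii would be attained
  at some \<open>r > 0\<close>. There the coupling terms \<open>G i r - G (s j i) r\<close> are nonnegative, so the damped
  component has a negative derivative and was larger before. The sign makes the
  singular factor \<open>1 / r\<close> harmless.\<close>

lemma radial_max_principle:
  fixes G G' :: "'i \<Rightarrow> real \<Rightarrow> real" and s :: "'j \<Rightarrow> 'i \<Rightarrow> 'i"
  assumes fin: "finite I"
    and cont: "\<And>i. i \<in> I \<Longrightarrow> continuous_on {0..1} (G i)"
    and init: "\<And>i. i \<in> I \<Longrightarrow> G i 0 \<le> 0"
    and der: "\<And>i r. i \<in> I \<Longrightarrow> 0 < r \<Longrightarrow> r \<le> 1 \<Longrightarrow> (G i has_real_derivative G' i r) (at r)"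
    and ineq: "\<And>i r. i \<in> I \<Longrightarrow> 0 < r \<Longrightarrow> r \<le> 1 \<Longrightarrow>
       G' i r \<le> a i * G i r - (\<Sum>j\<in>J. \<kappa> j * (G i r - G (s j i) r)) / r"
    and s: "\<And>i j. i \<in> I \<Longrightarrow> j \<in> J \<Longrightarrow> s j i \<in> I"
    and \<kappa>: "\<And>j. j \<in> J \<Longrightarrow> 0 \<le> \<kappa> j"
    and i: "i \<in> I"
  shows "G i 1 \<le> 0"
proof (rule ccontr)
  assume pos: "\<not> G i 1 \<le> 0"
  define A where "A = 1 + (\<Sum>i\<in>I. \<bar>a i\<bar>)"
  have A: "a i < A" if "i \<in> I" for i
    using member_le_sum[of i I "\<lambda>i. \<bar>a i\<bar>"] that fin unfolding A_def by auto
  \<comment> \<open>With this damping every diagonal coefficient of the system becomes negative.\<close>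
  define H where "H = (\<lambda>i r. exp (- A * r) * G i r)"
  have "\<exists>r\<in>{0..1}. \<forall>t\<in>{0..1}. H i t \<le> H i r" if "i \<in> I" for i
    unfolding H_def using cont[OF that]
    by (intro continuous_attains_sup continuous_intros) auto
  then obtain \<rho> where \<rho>: "\<And>i. i \<in> I \<Longrightarrow> \<rho> i \<in> {0..1}"
    "\<And>i t. i \<in> I \<Longrightarrow> t \<in> {0..1} \<Longrightarrow> H i t \<le> H i (\<rho> i)" by metis
  obtain m where m: "m \<in> I" "\<And>i. i \<in> I \<Longrightarrow> H i (\<rho> i) \<le> H m (\<rho> m)"
  proof -
    have "Max ((\<lambda>i. H i (\<rho> i)) ` I) \<in> (\<lambda>i. H i (\<rho> i)) ` I"
      using fin i by (intro Max_in) auto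
    then obtain m where "m \<in> I" "Max ((\<lambda>i. H i (\<rho> i)) ` I) = H m (\<rho> m)" by auto
    with Max_ge[OF finite_imageI[OF fin], of _ "\<lambda>i. H i (\<rho> i)"] show ?thesis
      by (intro that[of m]) auto
  qed
  define r where "r = \<rho> m"
  have top: "H i t \<le> H m r" if "i \<in> I" "t \<in> {0..1}" for i t
    using \<rho>(2)[OF that] m(2)[OF that(1)] unfolding r_def by linarith
  have "H i 1 \<le> H m r" using top i by auto
  moreover have "0 < H i 1" using pos by (auto simp: H_def)
  ultimately have Hpos: "0 < H m r" by linarith
  then have Gpos: "0 < G m r" by (simp add: H_def zero_less_mult_iff)
  have r: "0 < r" "r \<le> 1"
    using \<rho>(1)[OF m(1)] init[OF m(1)] Gpos unfolding r_def
    by (auto simp: less_le)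
  have dG: "G m r \<ge> G (s j m) r" if "j \<in> J" for j
    using top[OF s[OF m(1) that], of r] r by (auto simp: H_def)
  have "0 \<le> (\<Sum>j\<in>J. \<kappa> j * (G m r - G (s j m) r)) / r"
    using \<kappa> dG r by (intro divide_nonneg_pos sum_nonneg mult_nonneg_nonneg) auto
  then have "G' m r \<le> a m * G m r" using ineq[OF m(1) r] by linarith
  also have "\<dots> < A * G m r" using A[OF m(1)] Gpos by simp
  finally have lt: "G' m r < A * G m r" .
  have "(H m has_real_derivative exp (- A * r) * (G' m r - A * G m r)) (at r)"
    unfolding H_def using der[OF m(1) r]
    by (auto intro!: derivative_eq_intros simp: algebra_simps)
  moreover have "exp (- A * r) * (G' m r - A * G m r) < 0"
    using lt by (simp add: mult_pos_neg)
  ultimately obtain d where d: "d > 0" "\<And>h. h > 0 \<Longrightarrow> h < d \<Longrightarrow> H m r < H m (r - h)"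
    using DERIV_neg_dec_left by blast
  define h where "h = min (d / 2) r"
  have "H m r < H m (r - h)" using d r by (auto simp: h_def)
  moreover have "r - h \<in> {0..1}" using r d by (auto simp: h_def)
  ultimately show False using top[OF m(1), of "r - h"] by linarith
qed

section \<open>Elementary bounds for the Dunkl kernel\<close>

locale dunkl_kernel_data =
  fixes R Rp :: "'a::euclidean_space set" and k :: "'a \<Rightarrow> real" and D :: "'a \<Rightarrow> 'a \<Rightarrow> real"
  assumes finite_roots: "finite R"
    and root_nonzero: "\<beta> \<in> R \<Longrightarrow> \<beta> \<noteq> 0"
    and reflect_roots: "\<beta> \<in> R \<Longrightarrow> reflection \<beta> ` R \<subseteq> R"
    and Rp_subset: "Rp \<subseteq> R"
    and k_nonneg: "\<beta> \<in> R \<Longrightarrow> 0 \<le> k \<beta>"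
    and kernel: "dunkl_kernel Rp k D"
begin

lemma finite_Rp: "finite Rp"
  using finite_roots Rp_subset by (rule rev_finite_subset)

lemma k_nonneg': "\<beta> \<in> Rp \<Longrightarrow> 0 \<le> k \<beta>"
  using k_nonneg Rp_subset by blast

lemma kernel_eigen:
  "smooth (\<lambda>x. D x y)" "D 0 y = 1" "dunkl_operator Rp k \<xi> (\<lambda>x. D x y) x = (\<xi> \<bullet> y) * D x y"
proof -
  have "smooth (\<lambda>x. D x y) \<and> (\<lambda>x. D x y) 0 = 1 \<and>
    (\<forall>\<xi> x. dunkl_operator Rp k \<xi> (\<lambda>x. D x y) x = (\<xi> \<bullet> y) * (\<lambda>x. D x y) x)"
    using kernel unfolding dunkl_kernel_def by (metis (no_types, lifting))
  then show "smooth (\<lambda>x. D x y)" "D 0 y = 1"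
    "dunkl_operator Rp k \<xi> (\<lambda>x. D x y) x = (\<xi> \<bullet> y) * D x y" by auto
qed

lemma kernel_differentiable: "(\<lambda>x. D x y) differentiable (at x)"
proof -
  have "cont_diff (Suc 0) (\<lambda>x. D x y)" using kernel_eigen(1)[of y] unfolding smooth_def by blast
  then show ?thesis by simp
qed

lemma continuous_kernel: "continuous_on A (\<lambda>x. D x y)"
  using kernel_differentiable
  by (intro continuous_at_imp_continuous_on ballI differentiable_imp_continuous_within) auto

text \<open>The value that the eigenvalue equation in the direction \<open>\<xi> = x\<close> prescribes for the derivative of
  \<open>D(\<cdot>, y)\<close> at \<open>x\<close> along \<open>x\<close>; it involves no division by \<open>\<langle>\<beta>, x\<rangle>\<close>.\<close>

definition radial_derivative :: "'a \<Rightarrow> 'a \<Rightarrow> real" where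
  "radial_derivative x y = (x \<bullet> y) * D x y - (\<Sum>\<beta>\<in>Rp. k \<beta> * (D x y - D (reflection \<beta> x) y))"

text \<open>On the hyperplane of \<open>\<beta>\<close> the factor \<open>\<langle>\<beta>, x\<rangle>\<close> kills the limit in the definition of the quotient, and the
  difference \<open>D(x, y) - D(\<sigma>\<^sub>\<beta> x, y)\<close> vanishes as well.\<close>

lemma euler_identity: "frechet_derivative (\<lambda>x. D x y) (at x) x = radial_derivative x y"
proof -
  have "(\<beta> \<bullet> x) * dunkl_quotient \<beta> (\<lambda>x. D x y) x = D x y - D (reflection \<beta> x) y" for \<beta>
    by (auto simp: dunkl_quotient_def hyperplane_def reflection_def)
  then have "(\<Sum>\<beta>\<in>Rp. k \<beta> * (\<beta> \<bullet> x) * dunkl_quotient \<beta> (\<lambda>x. D x y) x)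
      = (\<Sum>\<beta>\<in>Rp. k \<beta> * (D x y - D (reflection \<beta> x) y))"
    by (simp add: mult.assoc)
  then show ?thesis
    using kernel_eigen(3)[of x y x] unfolding dunkl_operator_def radial_derivative_def by simp
qed

lemma kernel_radial_derivative:
  assumes "r \<noteq> 0"
  shows "((\<lambda>r. D (r *\<^sub>R u) y) has_real_derivative radial_derivative (r *\<^sub>R u) y / r) (at r)"
proof -
  let ?f = "\<lambda>x. D x y"
  let ?L = "frechet_derivative ?f (at (r *\<^sub>R u))"
  have L: "(?f has_derivative ?L) (at (r *\<^sub>R u))"
    using kernel_differentiable frechet_derivative_works by blast
  then interpret L: linear ?L by (rule has_derivative_linear)
  have "((\<lambda>r. r *\<^sub>R u) has_derivative (\<lambda>h. h *\<^sub>R u)) (at r)"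
    by (auto intro!: derivative_eq_intros)
  from diff_chain_at[OF this L]
  have "((\<lambda>r. D (r *\<^sub>R u) y) has_derivative (\<lambda>h. ?L (h *\<^sub>R u))) (at r)"
    by (simp add: o_def)
  moreover have "(\<lambda>h. ?L (h *\<^sub>R u)) = (*) (radial_derivative (r *\<^sub>R u) y / r)"
  proof
    fix h
    have "r * ?L u = radial_derivative (r *\<^sub>R u) y"
      using euler_identity[of y "r *\<^sub>R u"] L.scale[of r u] by simp
    then have "?L u = radial_derivative (r *\<^sub>R u) y / r" using assms by (simp add: field_simps)
    then show "?L (h *\<^sub>R u) = radial_derivative (r *\<^sub>R u) y / r * h"
      using L.scale[of h u] by (metis mult.commute real_scaleR_def)
  qed
  ultimately show ?thesis unfolding has_field_derivative_def by metis
qed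

lemma continuous_radial: "continuous_on A (\<lambda>r. D (r *\<^sub>R u) y)"
  by (rule continuous_on_compose2[OF continuous_kernel[of UNIV y]]) (auto intro!: continuous_intros)

text \<open>In this form the derivative along the ray of \<open>u\<close> has the shape required by the maximum principle, with
  the images \<open>\<sigma>\<^sub>\<beta> u\<close> as the coupled components.\<close>

lemma radial_derivative_ray:
  assumes "r \<noteq> 0"
  shows "radial_derivative (r *\<^sub>R u) y / r = (u \<bullet> y) * D (r *\<^sub>R u) y
    - (\<Sum>\<beta>\<in>Rp. k \<beta> * (D (r *\<^sub>R u) y - D (r *\<^sub>R reflection \<beta> u) y)) / r"
  using assms by (simp add: radial_derivative_def reflection_scaleR diff_divide_distrib)

text \<open>The exponential \<open>exp (r M)\<close> is the same in every component, so it is not seen by the coupling, and it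
  is a supersolution of the radial system with the initial value of the kernel.\<close>

lemma kernel_le_exp:
  assumes "finite U" and closed: "\<And>u \<beta>. u \<in> U \<Longrightarrow> \<beta> \<in> Rp \<Longrightarrow> reflection \<beta> u \<in> U"
    and M: "\<And>u. u \<in> U \<Longrightarrow> u \<bullet> y \<le> M" and "x \<in> U"
  shows "D x y \<le> exp M"
proof -
  have "D (1 *\<^sub>R x) y - exp (1 * M) \<le> 0"
  proof (rule radial_max_principle[where I = U and J = Rp and \<kappa> = k and s = reflection
        and G = "\<lambda>u r. D (r *\<^sub>R u) y - exp (r * M)" and a = "\<lambda>u. u \<bullet> y" and
        G' = "\<lambda>u r. radial_derivative (r *\<^sub>R u) y / r - M * exp (r * M)"])
    fix u r assume u: "u \<in> U" and r: "0 < r" "r \<le> (1::real)"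
    have "(u \<bullet> y) * exp (r * M) \<le> M * exp (r * M)" using M[OF u] by simp
    then show "radial_derivative (r *\<^sub>R u) y / r - M * exp (r * M)
       \<le> (u \<bullet> y) * (D (r *\<^sub>R u) y - exp (r * M)) - (\<Sum>\<beta>\<in>Rp. k \<beta> *
          (D (r *\<^sub>R u) y - exp (r * M) - (D (r *\<^sub>R reflection \<beta> u) y - exp (r * M)))) / r"
      using r by (simp add: radial_derivative_ray right_diff_distrib)
  qed (use assms k_nonneg' in \<open>auto intro!: continuous_intros continuous_radial derivative_eq_intros
         kernel_radial_derivative simp: kernel_eigen(2)\<close>)
  then show ?thesis by simp
qed

text \<open>Likewise \<open>exp (r M)\<close> is a subsolution. Positivity of the kernel follows with \<open>M = - |x| |y|\<close>.\<close>

lemma kernel_ge_exp: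
  assumes "finite U" and closed: "\<And>u \<beta>. u \<in> U \<Longrightarrow> \<beta> \<in> Rp \<Longrightarrow> reflection \<beta> u \<in> U"
    and M: "\<And>u. u \<in> U \<Longrightarrow> M \<le> u \<bullet> y" and "x \<in> U"
  shows "exp M \<le> D x y"
proof -
  have "exp (1 * M) - D (1 *\<^sub>R x) y \<le> 0"
  proof (rule radial_max_principle[where I = U and J = Rp and \<kappa> = k and s = reflection
        and G = "\<lambda>u r. exp (r * M) - D (r *\<^sub>R u) y" and a = "\<lambda>u. u \<bullet> y" and
        G' = "\<lambda>u r. M * exp (r * M) - radial_derivative (r *\<^sub>R u) y / r"])
    fix u r assume u: "u \<in> U" and r: "0 < r" "r \<le> (1::real)"
    have "M * exp (r * M) \<le> (u \<bullet> y) * exp (r * M)" using M[OF u] by simp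
    moreover have "(\<Sum>\<beta>\<in>Rp. k \<beta> *
          (exp (r * M) - D (r *\<^sub>R u) y - (exp (r * M) - D (r *\<^sub>R reflection \<beta> u) y)))
        = - (\<Sum>\<beta>\<in>Rp. k \<beta> * (D (r *\<^sub>R u) y - D (r *\<^sub>R reflection \<beta> u) y))"
      by (simp add: sum_negf[symmetric] algebra_simps)
    ultimately show "M * exp (r * M) - radial_derivative (r *\<^sub>R u) y / r
       \<le> (u \<bullet> y) * (exp (r * M) - D (r *\<^sub>R u) y) - (\<Sum>\<beta>\<in>Rp. k \<beta> *
          (exp (r * M) - D (r *\<^sub>R u) y - (exp (r * M) - D (r *\<^sub>R reflection \<beta> u) y))) / r"
      using r by (simp add: radial_derivative_ray right_diff_distrib)
  qed (use assms k_nonneg' in \<open>auto intro!: continuous_intros continuous_radial derivative_eq_intros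
         kernel_radial_derivative simp: kernel_eigen(2)\<close>)
  then show ?thesis by simp
qed

lemma finite_images: "finite (mirror_images R x)"
  using finite_roots reflect_roots by (rule finite_mirror_images)

lemma images_closed: "u \<in> mirror_images R x \<Longrightarrow> \<beta> \<in> Rp \<Longrightarrow> reflection \<beta> u \<in> mirror_images R x"
  using Rp_subset by (auto intro: mirror_images.reflect)

lemma kernel_pos: "0 < D x y"
proof -
  have "exp (- (norm x * norm y)) \<le> D x y"
  proof (rule kernel_ge_exp[OF finite_images images_closed _ mirror_images.start])
    fix u assume "u \<in> mirror_images R x"
    then show "- (norm x * norm y) \<le> u \<bullet> y"
      using Cauchy_Schwarz_ineq2[of u y] by (simp add: norm_mirror_images)
  qed
  then show ?thesis by (meson exp_gt_zero less_le_trans)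
qed

lemma kernel_le_exp_norm: "D x y \<le> exp (norm x * norm y)"
proof (rule kernel_le_exp[OF finite_images images_closed _ mirror_images.start])
  fix u assume "u \<in> mirror_images R x"
  then show "u \<bullet> y \<le> norm x * norm y"
    using norm_cauchy_schwarz[of u y] by (simp add: norm_mirror_images)
qed

lemma kernel_scale_ray_derivative:
  assumes "0 < c" "0 < r"
  shows "((\<lambda>r. D ((c * r) *\<^sub>R u) y) has_real_derivative radial_derivative ((c * r) *\<^sub>R u) y / r) (at r)"
proof -
  have "((\<lambda>r. D ((r * c) *\<^sub>R u) y) has_real_derivative
      radial_derivative (r *\<^sub>R (c *\<^sub>R u)) y / r) (at r)"
    using kernel_radial_derivative[of r "c *\<^sub>R u" y] assms by simp
  then show ?thesis by (simp add: mult.commute)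
qed

text \<open>Both sides, taken along the ray of \<open>x\<close>, solve the same radial system with initial value 1: the system
  depends on \<open>u\<close> and \<open>y\<close> only through the inner products \<open>\<langle>u, y\<rangle>\<close>. The maximum principle applied to the
  difference and to its negative gives uniqueness.\<close>

lemma kernel_homogeneous:
  assumes c: "0 < c"
  shows "D (c *\<^sub>R x) y = D x (c *\<^sub>R y)"
proof -
  let ?O = "mirror_images R x"
  let ?F = "\<lambda>u r. D ((c * r) *\<^sub>R u) y" and ?G = "\<lambda>u r. D (r *\<^sub>R u) (c *\<^sub>R y)"
  let ?F' = "\<lambda>u r. radial_derivative ((c * r) *\<^sub>R u) y / r"
  let ?G' = "\<lambda>u r. radial_derivative (r *\<^sub>R u) (c *\<^sub>R y) / r"
  have F': "?F' u r = (u \<bullet> (c *\<^sub>R y)) * ?F u r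
      - (\<Sum>\<beta>\<in>Rp. k \<beta> * (?F u r - ?F (reflection \<beta> u) r)) / r" if "0 < r" for u r
    using c that by (simp add: radial_derivative_def reflection_scaleR diff_divide_distrib)
  have G': "?G' u r = (u \<bullet> (c *\<^sub>R y)) * ?G u r
      - (\<Sum>\<beta>\<in>Rp. k \<beta> * (?G u r - ?G (reflection \<beta> u) r)) / r" if "0 < r" for u r
    using that by (simp add: radial_derivative_ray)
  have contF: "continuous_on A (?F u)" for A u
    using continuous_radial[of A "c *\<^sub>R u" y]
    by (simp add: mult.commute)
  have sums: "(\<Sum>\<beta>\<in>Rp. k \<beta> * (?F u r - ?G u r - (?F (reflection \<beta> u) r - ?G (reflection \<beta> u) r)))
     = (\<Sum>\<beta>\<in>Rp. k \<beta> * (?F u r - ?F (reflection \<beta> u) r))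
       - (\<Sum>\<beta>\<in>Rp. k \<beta> * (?G u r - ?G (reflection \<beta> u) r))"
    "(\<Sum>\<beta>\<in>Rp. k \<beta> * (?G u r - ?F u r - (?G (reflection \<beta> u) r - ?F (reflection \<beta> u) r)))
     = (\<Sum>\<beta>\<in>Rp. k \<beta> * (?G u r - ?G (reflection \<beta> u) r))
       - (\<Sum>\<beta>\<in>Rp. k \<beta> * (?F u r - ?F (reflection \<beta> u) r))" for u r
    by (simp_all add: sum_subtractf[symmetric] algebra_simps)
  have "?F x 1 - ?G x 1 \<le> 0"
  proof (rule radial_max_principle[where I = ?O and J = Rp and \<kappa> = k and s = reflection
        and G = "\<lambda>u r. ?F u r - ?G u r" and a = "\<lambda>u. u \<bullet> (c *\<^sub>R y)" and
        G' = "\<lambda>u r. ?F' u r - ?G' u r"])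
    show "?F' u r - ?G' u r \<le> (u \<bullet> (c *\<^sub>R y)) * (?F u r - ?G u r) - (\<Sum>\<beta>\<in>Rp. k \<beta> *
        (?F u r - ?G u r - (?F (reflection \<beta> u) r - ?G (reflection \<beta> u) r))) / r"
      if "0 < r" for u r
      using that unfolding sums F'[OF that] G'[OF that]
      by (simp add: algebra_simps diff_divide_distrib)
    show "((\<lambda>r. ?F u r - ?G u r) has_real_derivative ?F' u r - ?G' u r) (at r)" if "0 < r" for u r
      using that c by (intro DERIV_diff kernel_scale_ray_derivative kernel_radial_derivative) auto
  qed (use finite_images images_closed k_nonneg' in \<open>auto intro!: continuous_on_diff contF
        continuous_radial mirror_images.start simp: kernel_eigen(2)\<close>)
  moreover have "?G x 1 - ?F x 1 \<le> 0"
  proof (rule radial_max_principle[where I = ?O and J = Rp and \<kappa> = k and s = reflection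
        and G = "\<lambda>u r. ?G u r - ?F u r" and a = "\<lambda>u. u \<bullet> (c *\<^sub>R y)" and
        G' = "\<lambda>u r. ?G' u r - ?F' u r"])
    show "?G' u r - ?F' u r \<le> (u \<bullet> (c *\<^sub>R y)) * (?G u r - ?F u r) - (\<Sum>\<beta>\<in>Rp. k \<beta> *
        (?G u r - ?F u r - (?G (reflection \<beta> u) r - ?F (reflection \<beta> u) r))) / r"
      if "0 < r" for u r
      using that unfolding sums F'[OF that] G'[OF that]
      by (simp add: algebra_simps diff_divide_distrib)
    show "((\<lambda>r. ?G u r - ?F u r) has_real_derivative ?G' u r - ?F' u r) (at r)" if "0 < r" for u r
      using that c by (intro DERIV_diff kernel_scale_ray_derivative kernel_radial_derivative) auto
  qed (use finite_images images_closed k_nonneg' in \<open>auto intro!: continuous_on_diff contF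
        continuous_radial mirror_images.start simp: kernel_eigen(2)\<close>)
  ultimately show ?thesis by simp
qed

end

section \<open>Gaussian estimates\<close>

lemma inner_powr_le_exp:
  fixes \<beta> y :: "'a::real_inner"
  assumes "0 \<le> p"
  shows "\<bar>\<beta> \<bullet> y\<bar> powr p \<le> exp (p * norm \<beta> * norm y)"
proof -
  have "\<bar>\<beta> \<bullet> y\<bar> \<le> exp (norm \<beta> * norm y)"
    using Cauchy_Schwarz_ineq2[of \<beta> y] exp_ge_add_one_self[of "norm \<beta> * norm y"] by linarith
  then have "\<bar>\<beta> \<bullet> y\<bar> powr p \<le> exp (norm \<beta> * norm y) powr p" using assms by (intro powr_mono2) auto
  then show ?thesis by (simp add: powr_def mult.assoc)
qed

lemma powr_exp_derivative:
  fixes c q n t :: real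
  assumes "0 < t"
  shows "((\<lambda>t. c * t powr q * exp (t * n)) has_real_derivative c * t powr q * exp (t * n) * (q / t + n)) (at t)"
proof -
  have "t powr (q - 1) = t powr q / t" using assms by (simp add: powr_diff)
  then show ?thesis
    using assms by (auto intro!: derivative_eq_intros simp: field_simps)
qed

lemma norm_sq_le_exp: "(norm (y::'a::real_normed_vector))\<^sup>2 \<le> 2 * exp (norm y)"
  using exp_lower_Taylor_quadratic[OF norm_ge_zero, of y] norm_ge_zero[of y] by linarith

lemma norm_le_exp: "norm (y::'a::real_normed_vector) \<le> exp (norm y)"
  using exp_ge_add_one_self[of "norm y"] by linarith

text \<open>Raising \<open>v \<le> exp v\<close> at \<open>v = a / (q s)\<close> to the power \<open>q\<close>.\<close>

lemma powr_exp_le: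
  fixes a q s :: real
  assumes "0 < a" "0 < q" "0 < s"
  shows "s powr (- q) * exp (- a / s) \<le> (a / q) powr (- q)"
proof -
  have "a / (q * s) \<le> exp (a / (q * s))"
    using exp_ge_add_one_self[of "a / (q * s)"] by linarith
  then have "(a / (q * s)) powr q \<le> exp (a / (q * s)) powr q"
    using assms by (intro powr_mono2) auto
  also have "exp (a / (q * s)) powr q = exp (a / s)" using assms by (simp add: powr_def)
  also have "(a / (q * s)) powr q = (a / q) powr q * s powr (- q)"
    using assms by (simp add: powr_divide powr_mult powr_minus divide_simps)
  finally have "(a / q) powr q * s powr (- q) \<le> exp (a / s)" .
  then show ?thesis
    using assms by (simp add: powr_minus exp_minus divide_simps mult.commute)
qed

lemma finite_positive_lower_bound:
  fixes A :: "real set"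
  assumes "finite A" "\<And>a. a \<in> A \<Longrightarrow> 0 < a"
  obtains d where "0 < d" "d \<le> 1" "\<And>a. a \<in> A \<Longrightarrow> d \<le> a"
  using that[of "Min (insert 1 A)"] assms by (auto intro!: Min_le)

lemma integrable_gaussian:
  assumes e: "0 < e"
  shows "integrable lborel (\<lambda>y::'a::euclidean_space. exp (- e * (norm y)\<^sup>2))"
proof (rule integrableI_nonneg)
  define \<sigma> where "\<sigma> = 1 / sqrt (2 * e)"
  have \<sigma>: "2 * \<sigma>\<^sup>2 = 1 / e" using e by (simp add: \<sigma>_def power_divide)
  have one: "(\<integral>\<^sup>+v. ennreal (exp (- e * v\<^sup>2)) \<partial>lborel) < \<infinity>"
  proof -
    have "exp (- e * v\<^sup>2) = sqrt (2 * pi * \<sigma>\<^sup>2) * normal_density 0 \<sigma> v" for v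
      using e \<sigma> unfolding normal_density_def by (simp add: \<sigma>_def)
    then have "integrable lborel (\<lambda>v. exp (- e * v\<^sup>2))"
      using integrable_normal_density[of 0 \<sigma>] e by (auto simp: \<sigma>_def)
    then show ?thesis by (simp add: integrable_iff_bounded)
  qed
  have "exp (- e * (norm y)\<^sup>2) = (\<Prod>b\<in>Basis. exp (- e * (y \<bullet> b)\<^sup>2))" for y :: 'a
  proof -
    have "(norm y)\<^sup>2 = (\<Sum>b\<in>Basis. (y \<bullet> b)\<^sup>2)"
      unfolding power2_norm_eq_inner by (subst euclidean_inner) (simp add: power2_eq_square)
    then show ?thesis by (simp add: exp_sum[symmetric] sum_distrib_left sum_negf)
  qed
  then have "(\<integral>\<^sup>+y. ennreal (exp (- e * (norm (y::'a))\<^sup>2)) \<partial>lborel)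
     = (\<integral>\<^sup>+y. (\<Prod>b\<in>Basis. ennreal (exp (- e * (y \<bullet> b)\<^sup>2))) \<partial>(lborel :: 'a measure))"
    by (simp add: prod_ennreal)
  also have "\<dots> = (\<Prod>b\<in>(Basis::'a set). (\<integral>\<^sup>+v. ennreal (exp (- e * v\<^sup>2)) \<partial>lborel))"
    by (rule nn_integral_lborel_prod) auto
  also have "\<dots> < \<infinity>" using one by (simp add: power_less_top_ennreal)
  finally show "(\<integral>\<^sup>+y. ennreal (exp (- e * (norm (y::'a))\<^sup>2)) \<partial>lborel) < \<infinity>" .
qed auto

text \<open>Trades half of a Gaussian exponent for an arbitrary exponential growth.\<close>

lemma linear_le_quadratic:
  fixes b e v :: real
  assumes e: "0 < e"
  shows "b * v - e * v\<^sup>2 \<le> b\<^sup>2 / (2 * e) - e / 2 * v\<^sup>2"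
proof -
  have "0 \<le> (e * v - b)\<^sup>2 / (2 * e)" using e by simp
  also have "\<dots> = b\<^sup>2 / (2 * e) + e / 2 * v\<^sup>2 - b * v"
    using e by (simp add: power2_eq_square field_simps)
  finally show ?thesis by simp
qed

lemma integrable_exp_gaussian:
  assumes e: "0 < e"
  shows "integrable lborel (\<lambda>y::'a::euclidean_space. exp (b * norm y - e * (norm y)\<^sup>2))"
proof (rule Bochner_Integration.integrable_bound)
  show "integrable lborel (\<lambda>y::'a. exp (b\<^sup>2 / (2 * e)) * exp (- (e / 2) * (norm y)\<^sup>2))"
    using e by (intro integrable_mult_right integrable_gaussian) auto
  have "b * norm y - e * (norm y)\<^sup>2 \<le> b\<^sup>2 / (2 * e) + (- (e / 2) * (norm y)\<^sup>2)" for y :: 'a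
    using linear_le_quadratic[OF e, of b "norm y"] by simp
  then show "AE y in lborel. norm (exp (b * norm (y::'a) - e * (norm y)\<^sup>2))
     \<le> norm (exp (b\<^sup>2 / (2 * e)) * exp (- (e / 2) * (norm y)\<^sup>2))"
    by (auto simp: exp_add[symmetric])
qed simp

lemma nn_integral_powr_near_0:
  assumes a: "- 1 < a"
  shows "(\<integral>\<^sup>+v. ennreal (\<bar>v::real\<bar> powr a * indicator {-1..1} v) \<partial>lborel) < \<infinity>"
proof -
  let ?f = "\<lambda>v::real. v powr a * indicator {0..1} v"
  have "((\<lambda>v. v powr a) has_integral (1 powr (a + 1) / (a + 1))) {0..1}"
    using has_integral_powr_from_0[OF a, of 1] by simp
  then have "(?f has_integral (1 powr (a + 1) / (a + 1))) UNIV"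
    by (subst (asm) has_integral_restrict_UNIV[symmetric])
       (simp add: indicator_def of_bool_def if_distrib cong: if_cong)
  then have half: "(\<integral>\<^sup>+v. ennreal (?f v) \<partial>lborel) = ennreal (1 powr (a + 1) / (a + 1))"
    by (intro nn_integral_has_integral_lborel) auto
  have "(\<integral>\<^sup>+v. ennreal (\<bar>v::real\<bar> powr a * indicator {-1..1} v) \<partial>lborel)
     \<le> (\<integral>\<^sup>+v. ennreal (?f v) + ennreal (?f (0 + (- 1) * v)) \<partial>lborel)"
    by (intro nn_integral_mono) (auto simp: indicator_def ennreal_plus[symmetric] simp del: ennreal_plus)
  also have "\<dots> = (\<integral>\<^sup>+v. ennreal (?f v) \<partial>lborel) + (\<integral>\<^sup>+v. ennreal (?f (0 + (- 1) * v)) \<partial>lborel)"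
    by (intro nn_integral_add) auto
  also have "(\<integral>\<^sup>+v. ennreal (?f (0 + (- 1) * v)) \<partial>lborel) = (\<integral>\<^sup>+v. ennreal (?f v) \<partial>lborel)"
    by (subst (2) nn_integral_real_affine[where c = "-1" and t = 0]) auto
  finally show ?thesis unfolding half by (simp add: le_less_trans)
qed

lemma norm_shift_lower:
  fixes u y :: "'a::real_normed_vector"
  shows "(norm y)\<^sup>2 / 2 - (norm u)\<^sup>2 \<le> (norm (u + y))\<^sup>2"
proof -
  have "norm y \<le> norm (u + y) + norm u" using norm_triangle_ineq4[of "u + y" u] by simp
  then have "(norm y)\<^sup>2 \<le> (norm (u + y) + norm u)\<^sup>2" by (intro power_mono) auto
  also have "\<dots> \<le> 2 * (norm (u + y))\<^sup>2 + 2 * (norm u)\<^sup>2"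
    using sum_squares_bound[of "norm (u + y)" "norm u"] by (simp add: power2_sum)
  finally show ?thesis by simp
qed

lemma nn_integral_lborel_shift:
  fixes f :: "'a::euclidean_space \<Rightarrow> ennreal"
  assumes [measurable]: "f \<in> borel_measurable borel"
  shows "(\<integral>\<^sup>+y. f (u + y) \<partial>lborel) = (\<integral>\<^sup>+y. f y \<partial>lborel)"
  by (subst (2) lborel_distr_plus[symmetric, of u], subst nn_integral_distr) auto

text \<open>By translation invariance the integral equals its average over the translates by \<open>s \<alpha>\<close>, \<open>0 \<le> s \<le> 1\<close>.
  Carrying out the average first replaces the singular factor by its finite one-dimensional integral, up
  to the factor \<open>|\<alpha>|\<^sup>-\<^sup>2\<close>, while the Gaussian changes only by constants. This
  avoids coordinates adapted to \<open>\<alpha>\<close>.\<close>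

lemma nn_integral_slab_gaussian:
  fixes \<alpha> :: "'a::euclidean_space"
  assumes a: "- 1 < a" and \<alpha>: "\<alpha> \<noteq> 0" and e: "0 < e"
  shows "(\<integral>\<^sup>+y. ennreal (\<bar>\<alpha> \<bullet> y\<bar> powr a * indicator {-1..1} (\<alpha> \<bullet> y) * exp (- e * (norm y)\<^sup>2)) \<partial>lborel) < \<infinity>"
proof -
  define \<phi> :: "real \<Rightarrow> real" where "\<phi> = (\<lambda>v. \<bar>v\<bar> powr a * indicator {-1..1} v)"
  have [measurable]: "\<phi> \<in> borel_measurable borel" unfolding \<phi>_def by measurable
  have \<phi>0: "0 \<le> \<phi> v" for v by (simp add: \<phi>_def)
  define g where "g = (\<lambda>y. ennreal (\<phi> (\<alpha> \<bullet> y) * exp (- e * (norm y)\<^sup>2)))"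
  have [measurable]: "g \<in> borel_measurable borel" unfolding g_def by measurable
  define c where "c = \<alpha> \<bullet> \<alpha>"
  have c: "0 < c" using \<alpha> by (simp add: c_def)
  define J where "J = (\<integral>\<^sup>+v. ennreal (\<phi> v) \<partial>lborel)"
  have J: "J < \<infinity>" unfolding J_def \<phi>_def by (rule nn_integral_powr_near_0[OF a])
  define B where "B = (\<lambda>y::'a. exp (e * c) * exp (- (e / 2) * (norm y)\<^sup>2))"
  have B0: "0 \<le> B y" for y by (simp add: B_def)
  have gB: "g (s *\<^sub>R \<alpha> + y) \<le> ennreal (B y) * ennreal (\<phi> (\<alpha> \<bullet> y + c * s))" if "s \<in> {0..1}" for s y
  proof -
    have "s\<^sup>2 * c \<le> 1 * c" using that c by (intro mult_right_mono) (auto simp: power_le_one)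
    then have "(norm (s *\<^sub>R \<alpha>))\<^sup>2 \<le> c"
      by (simp add: power_mult_distrib c_def power2_norm_eq_inner)
    then have "(norm y)\<^sup>2 / 2 - c \<le> (norm (s *\<^sub>R \<alpha> + y))\<^sup>2"
      using norm_shift_lower[of y "s *\<^sub>R \<alpha>"] by linarith
    then have "e * ((norm y)\<^sup>2 / 2 - c) \<le> e * (norm (s *\<^sub>R \<alpha> + y))\<^sup>2" using e by simp
    then have "exp (- e * (norm (s *\<^sub>R \<alpha> + y))\<^sup>2) \<le> B y"
      by (simp add: B_def exp_add[symmetric] right_diff_distrib)
    moreover have "\<alpha> \<bullet> (s *\<^sub>R \<alpha> + y) = \<alpha> \<bullet> y + c * s" by (simp add: inner_add_right c_def)
    ultimately have "\<phi> (\<alpha> \<bullet> (s *\<^sub>R \<alpha> + y)) * exp (- e * (norm (s *\<^sub>R \<alpha> + y))\<^sup>2)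
       \<le> B y * \<phi> (\<alpha> \<bullet> y + c * s)"
      using mult_right_mono[OF _ \<phi>0, of "exp (- e * (norm (s *\<^sub>R \<alpha> + y))\<^sup>2)" "B y"] by (simp add: mult.commute)
    then show ?thesis unfolding g_def using \<phi>0 by (simp add: ennreal_mult'[symmetric] B_def)
  qed
  have inner: "(\<integral>\<^sup>+s. ennreal (\<phi> (b + c * s)) \<partial>lborel) = J / ennreal c" for b
    using nn_integral_real_affine[of "\<lambda>v. ennreal (\<phi> v)" c b] c
    by (simp add: J_def ennreal_mult_divide_eq mult.commute[of "ennreal c"])
  have "(\<integral>\<^sup>+y. g y \<partial>lborel) = (\<integral>\<^sup>+s. (\<integral>\<^sup>+y. g y \<partial>lborel) * indicator {0..1::real} s \<partial>lborel)"
    by (subst nn_integral_cmult_indicator) auto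
  also have "\<dots> = (\<integral>\<^sup>+s. (\<integral>\<^sup>+y. g (s *\<^sub>R \<alpha> + y) * indicator {0..1::real} s \<partial>lborel) \<partial>lborel)"
    by (subst nn_integral_multc) (auto simp: nn_integral_lborel_shift)
  also have "\<dots> = (\<integral>\<^sup>+y. (\<integral>\<^sup>+s. g (s *\<^sub>R \<alpha> + y) * indicator {0..1::real} s \<partial>lborel) \<partial>lborel)"
    by (rule lborel_pair.Fubini') simp
  also have "\<dots> \<le> (\<integral>\<^sup>+y. (\<integral>\<^sup>+s. ennreal (B y) * ennreal (\<phi> (\<alpha> \<bullet> y + c * s)) \<partial>lborel) \<partial>lborel)"
    using gB by (intro nn_integral_mono) (auto simp: indicator_def)
  also have "\<dots> = (\<integral>\<^sup>+y. ennreal (B y) * (J / ennreal c) \<partial>lborel)"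
    by (subst nn_integral_cmult) (auto simp: inner)
  also have "\<dots> = (\<integral>\<^sup>+y. ennreal (B y) \<partial>lborel) * (J / ennreal c)"
    by (rule nn_integral_multc) (simp add: B_def)
  also have "\<dots> < \<infinity>"
  proof -
    have "integrable lborel B"
      unfolding B_def using e by (intro integrable_mult_right integrable_gaussian) auto
    then have "(\<integral>\<^sup>+y. ennreal (B y) \<partial>lborel) < \<infinity>"
      using B0 by (simp add: integrable_iff_bounded)
    then show ?thesis using J c by (cases J) (auto simp: ennreal_mult_less_top divide_ennreal)
  qed
  finally show ?thesis unfolding g_def \<phi>_def .
qed

section \<open>The Dunkl heat integrand\<close>

context dunkl_kernel_data
begin

lemma weight_measurable [measurable]: "dunkl_weight Rp k \<in> borel_measurable borel"
  unfolding dunkl_weight_def by measurable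

lemma weight_nonneg: "0 \<le> dunkl_weight Rp k y"
  unfolding dunkl_weight_def by (intro prod_nonneg) auto

text \<open>A rate with \<open>\<omega>\<^sub>k(y) \<le> exp (growth |y|)\<close>; an exponential bound of the weight combines directly with
  the exponential bound of the kernel and with Gaussians.\<close>

definition growth :: real where
  "growth = (\<Sum>\<beta>\<in>Rp. 2 * k \<beta> * norm \<beta>)"

lemma partial_weight_le_exp:
  assumes "P \<subseteq> Rp"
  shows "(\<Prod>\<beta>\<in>P. \<bar>\<beta> \<bullet> y\<bar> powr (2 * k \<beta>)) \<le> exp (growth * norm y)"
proof -
  have "(\<Prod>\<beta>\<in>P. \<bar>\<beta> \<bullet> y\<bar> powr (2 * k \<beta>)) \<le> (\<Prod>\<beta>\<in>P. exp (2 * k \<beta> * norm \<beta> * norm y))"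
    using assms k_nonneg' by (intro prod_mono conjI inner_powr_le_exp) auto
  also have "\<dots> = exp ((\<Sum>\<beta>\<in>P. 2 * k \<beta> * norm \<beta>) * norm y)"
    using finite_subset[OF assms finite_Rp] by (simp add: exp_sum sum_distrib_right)
  also have "\<dots> \<le> exp (growth * norm y)"
    unfolding growth_def using assms k_nonneg'
    by (auto intro!: mult_right_mono sum_mono2 finite_Rp)
  finally show ?thesis .
qed

lemma weight_le_exp: "dunkl_weight Rp k y \<le> exp (growth * norm y)"
  unfolding dunkl_weight_def by (rule partial_weight_le_exp) simp

text \<open>Up to a factor depending on \<open>t\<close> and \<open>z\<close> only, the transition density from \<open>z = t x\<close> in time \<open>t\<close>. By
  homogeneity of the kernel, \<open>t\<close> enters only through the Gaussian, which makes differentiation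
  in \<open>t\<close> possible without any knowledge of the \<open>t\<close>-derivative of the kernel.\<close>

definition heat :: "real \<Rightarrow> 'a \<Rightarrow> 'a \<Rightarrow> real" where
  "heat t x y = exp (- (norm y)\<^sup>2 / (2 * t)) * D x y * dunkl_weight Rp k y"

lemma heat_nonneg: "0 \<le> heat t x y"
  unfolding heat_def by (intro mult_nonneg_nonneg weight_nonneg less_imp_le[OF kernel_pos]) simp

definition heat_bound :: "real \<Rightarrow> real \<Rightarrow> 'a \<Rightarrow> real" where
  "heat_bound t b y = exp ((b + growth) * norm y - 1 / (2 * t) * (norm y)\<^sup>2)"

lemma integrable_heat_bound: "0 < t \<Longrightarrow> integrable lborel (heat_bound t b)"
  unfolding heat_bound_def by (intro integrable_exp_gaussian) auto

lemma gauss_weight_le_heat_bound: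
  "exp (b * norm y) * (exp (- (norm y)\<^sup>2 / (2 * t)) * dunkl_weight Rp k y) \<le> heat_bound t b y"
proof -
  have "exp (b * norm y) * (exp (- (norm y)\<^sup>2 / (2 * t)) * dunkl_weight Rp k y)
      \<le> exp (b * norm y) * (exp (- (norm y)\<^sup>2 / (2 * t)) * exp (growth * norm y))"
    using weight_le_exp by (intro mult_left_mono) auto
  also have "\<dots> = heat_bound t b y"
    unfolding heat_bound_def exp_add[symmetric] by (simp add: algebra_simps)
  finally show ?thesis .
qed

lemma heat_le_bound:
  assumes "norm x \<le> b"
  shows "heat t x y \<le> heat_bound t b y"
proof -
  have "D x y \<le> exp (b * norm y)"
    using kernel_le_exp_norm[of x y] assms
    by (meson exp_le_cancel_iff mult_right_mono norm_ge_zero order_trans)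
  then have "heat t x y \<le> exp (b * norm y) * (exp (- (norm y)\<^sup>2 / (2 * t)) * dunkl_weight Rp k y)"
    unfolding heat_def using mult_right_mono[OF _ mult_nonneg_nonneg[OF exp_ge_zero weight_nonneg],
        of "D x y" "exp (b * norm y)" "- (norm y)\<^sup>2 / (2 * t)" y]
    by (simp add: mult.commute mult.left_commute)
  then show ?thesis using gauss_weight_le_heat_bound order_trans by blast
qed

lemma heat_integral_continuous:
  assumes t: "0 < t" and z: "z \<longlonglongrightarrow> x"
    and [measurable]: "\<And>n. heat t (z n) \<in> borel_measurable lborel"
  shows "heat t x \<in> borel_measurable lborel"
    and "(\<lambda>n. LINT y|lborel. heat t (z n) y) \<longlonglongrightarrow> (LINT y|lborel. heat t x y)"
proof -
  have lim: "(\<lambda>n. heat t (z n) y) \<longlonglongrightarrow> heat t x y" for y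
  proof -
    have "isCont (\<lambda>x. D x y) x" using continuous_kernel[of UNIV y] by (simp add: continuous_on_eq_continuous_at)
    then have "(\<lambda>n. D (z n) y) \<longlonglongrightarrow> D x y" using z by (rule isCont_tendsto_compose)
    then show ?thesis unfolding heat_def by (intro tendsto_intros)
  qed
  then show m: "heat t x \<in> borel_measurable lborel"
    using borel_measurable_LIMSEQ_real[of lborel "\<lambda>n. heat t (z n)" "heat t x"] by simp
  obtain b where b: "\<And>n. norm (z n) \<le> b"
    using convergent_imp_Bseq[OF convergentI[OF z]] unfolding Bseq_def by blast
  show "(\<lambda>n. LINT y|lborel. heat t (z n) y) \<longlonglongrightarrow> (LINT y|lborel. heat t x y)"
    using lim b m heat_nonneg
    by (intro integral_dominated_convergence[where w = "heat_bound t b"] integrable_heat_bound t)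
       (auto intro!: heat_le_bound AE_I2)
qed

end

section \<open>Moments of the Dunkl semigroup\<close>

context dunkl_kernel_data
begin

abbreviation (input) order :: real where
  "order \<equiv> dunkl_gamma Rp k + real DIM('a) / 2"

text \<open>The integral over \<open>y\<close> that \<open>heat t x y\<close> must have for the transition densities to have total mass one.\<close>

definition mass :: "real \<Rightarrow> 'a \<Rightarrow> real" where
  "mass t x = dunkl_const Rp k * t powr order * exp (t * (norm x)\<^sup>2 / 2)"

lemma density_eq_heat:
  assumes t: "0 < t"
  shows "dunkl_density Rp k D t z y = heat t (z /\<^sub>R t) y / mass t (z /\<^sub>R t)"
proof -
  have "D (z /\<^sub>R sqrt t) (y /\<^sub>R sqrt t) = D (inverse (sqrt t) *\<^sub>R (z /\<^sub>R sqrt t)) y"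
    using t by (intro kernel_homogeneous[symmetric]) simp
  also have "inverse (sqrt t) *\<^sub>R (z /\<^sub>R sqrt t) = z /\<^sub>R t"
    using t by (simp add: inverse_mult_distrib[symmetric] del: inverse_mult_distrib)
  finally have D: "D (z /\<^sub>R sqrt t) (y /\<^sub>R sqrt t) = D (z /\<^sub>R t) y" .
  have m: "t * (norm (z /\<^sub>R t))\<^sup>2 / 2 = (norm z)\<^sup>2 / (2 * t)"
    using t by (simp add: field_simps power2_eq_square)
  have "- ((norm z)\<^sup>2 + (norm y)\<^sup>2) / (2 * t) = - (norm y)\<^sup>2 / (2 * t) - (norm z)\<^sup>2 / (2 * t)"
    by (simp add: add_divide_distrib diff_divide_distrib)
  then have "exp (- ((norm z)\<^sup>2 + (norm y)\<^sup>2) / (2 * t))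
     = exp (- (norm y)\<^sup>2 / (2 * t)) / exp ((norm z)\<^sup>2 / (2 * t))"
    by (simp only: exp_diff)
  then show ?thesis
    unfolding dunkl_density_def heat_def mass_def D m by simp
qed

end

text \<open>The analytic part of the argument uses the process only through this mass identity.\<close>

locale dunkl_normalised = dunkl_kernel_data +
  assumes const_pos: "0 < dunkl_const Rp k"
    and heat_integrable: "0 < t \<Longrightarrow> integrable lborel (heat t x)"
    and heat_mass: "0 < t \<Longrightarrow> (LINT y|lborel. heat t x y) = mass t x"
begin

lemma mass_pos: "0 < t \<Longrightarrow> 0 < mass t x"
  unfolding mass_def using const_pos by simp

lemma mass_reflection: "mass t (reflection \<beta> x) = mass t x"
  by (simp add: mass_def)

lemma mass_time_derivative:
  assumes "0 < t"
  shows "((\<lambda>t. mass t x) has_real_derivative mass t x * (order / t + (norm x)\<^sup>2 / 2)) (at t)"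
  unfolding mass_def
  using powr_exp_derivative[OF assms, of "dunkl_const Rp k" order "(norm x)\<^sup>2 / 2"] by simp

lemma mass_ray_derivative:
  "((\<lambda>r. mass t (r *\<^sub>R x)) has_real_derivative mass t x * (t * (norm x)\<^sup>2)) (at 1)"
  unfolding mass_def
  by (auto intro!: derivative_eq_intros simp: power_mult_distrib)

lemma integrable_heat_times:
  assumes t: "0 < t" and [measurable]: "g \<in> borel_measurable borel"
    and g: "\<And>y. \<bar>g y\<bar> \<le> C * exp (norm y)" and C: "0 \<le> C"
  shows "integrable lborel (\<lambda>y. g y * heat t x y)"
proof (rule Bochner_Integration.integrable_bound)
  show "integrable lborel (\<lambda>y. C * heat_bound t (norm x + 1) y)"
    using t by (intro integrable_mult_right integrable_heat_bound)
  show "(\<lambda>y. g y * heat t x y) \<in> borel_measurable lborel"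
    using heat_integrable[OF t, of x] by measurable
  show "AE y in lborel. norm (g y * heat t x y) \<le> norm (C * heat_bound t (norm x + 1) y)"
  proof (rule AE_I2)
    fix y
    have "\<bar>g y\<bar> * heat t x y \<le> (C * exp (norm y)) * heat_bound t (norm x) y"
      using g C by (intro mult_mono heat_le_bound heat_nonneg mult_nonneg_nonneg) auto
    also have "\<dots> = C * heat_bound t (norm x + 1) y"
      by (simp add: heat_bound_def exp_add[symmetric] algebra_simps)
    finally show "norm (g y * heat t x y) \<le> norm (C * heat_bound t (norm x + 1) y)"
      using heat_nonneg C by (simp add: abs_mult heat_bound_def)
  qed
qed

lemma integrable_inner_heat:
  assumes "0 < t" shows "integrable lborel (\<lambda>y. (v \<bullet> y) * heat t x y)"
proof (rule integrable_heat_times[OF assms])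
  fix y
  show "\<bar>v \<bullet> y\<bar> \<le> norm v * exp (norm y)"
    using Cauchy_Schwarz_ineq2[of v y] mult_left_mono[OF norm_le_exp[of y], of "norm v"] by simp
qed auto

lemma integrable_norm_sq_heat:
  assumes "0 < t" shows "integrable lborel (\<lambda>y. (norm y)\<^sup>2 * heat t x y)"
  by (rule integrable_heat_times[OF assms, where C = 2]) (auto simp: norm_sq_le_exp)

text \<open>By convexity of the exponential the integrand is at most the increment quotient of \<open>heat\<close> in the
  variable \<open>- 1 / (2 t)\<close>, whose integral is known from \<open>mass\<close>; then let the increment tend to 0.\<close>

lemma second_moment_le:
  assumes t: "0 < t"
  shows "(LINT y|lborel. (norm y)\<^sup>2 * heat t x y) \<le> mass t x * (2 * order * t + t\<^sup>2 * (norm x)\<^sup>2)"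
proof -
  define h where "h = (\<lambda>n. inverse (real (Suc n)))"
  have h: "0 < h n" for n by (simp add: h_def)
  have h0: "h \<longlonglongrightarrow> 0" unfolding h_def by (rule LIMSEQ_inverse_real_of_nat)
  have le: "(LINT y|lborel. (norm y)\<^sup>2 * heat t x y)
     \<le> (mass (t + h n) x - mass t x) / h n * (2 * t * (t + h n))" for n
  proof -
    define d where "d = h n / (2 * t * (t + h n))"
    have d: "0 < d" using h[of n] t by (simp add: d_def)
    have "d * ((norm y)\<^sup>2 * heat t x y) \<le> heat (t + h n) x y - heat t x y" for y
    proof -
      define b b' where "b = (norm y)\<^sup>2 / (2 * t)" and "b' = (norm y)\<^sup>2 / (2 * (t + h n))"
      have bb: "b - b' = d * (norm y)\<^sup>2"
        using h[of n] t unfolding b_def b'_def d_def by (simp add: divide_simps) (simp add: algebra_simps)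
      have "exp (- b) * (1 + (b - b')) \<le> exp (- b) * exp (b - b')"
        by (intro mult_left_mono exp_ge_add_one_self) auto
      also have "\<dots> = exp (- b')" by (simp add: exp_add[symmetric])
      finally have "d * (norm y)\<^sup>2 * exp (- b) \<le> exp (- b') - exp (- b)"
        by (simp add: bb algebra_simps)
      then have "d * (norm y)\<^sup>2 * exp (- b) * (D x y * dunkl_weight Rp k y)
         \<le> (exp (- b') - exp (- b)) * (D x y * dunkl_weight Rp k y)"
        by (intro mult_right_mono mult_nonneg_nonneg weight_nonneg less_imp_le[OF kernel_pos])
      then show ?thesis by (simp add: heat_def b_def b'_def algebra_simps)
    qed
    then have "(LINT y|lborel. d * ((norm y)\<^sup>2 * heat t x y)) \<le> (LINT y|lborel. heat (t + h n) x y - heat t x y)"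
      using t h[of n] by (intro integral_mono integrable_mult_right integrable_norm_sq_heat
          Bochner_Integration.integrable_diff heat_integrable) auto
    also have "\<dots> = mass (t + h n) x - mass t x"
      using t h[of n] by (simp add: heat_integrable heat_mass)
    finally have "(LINT y|lborel. (norm y)\<^sup>2 * heat t x y) \<le> (mass (t + h n) x - mass t x) / d"
      using d by (simp add: pos_le_divide_eq mult.commute)
    then show ?thesis by (simp add: d_def)
  qed
  have "(\<lambda>n. (mass (t + h n) x - mass t x) / h n) \<longlonglongrightarrow> mass t x * (order / t + (norm x)\<^sup>2 / 2)"
  proof -
    have "((\<lambda>h. (mass (t + h) x - mass t x) / h) \<longlongrightarrow> mass t x * (order / t + (norm x)\<^sup>2 / 2)) (at 0)"
      using mass_time_derivative[OF t, of x] by (simp add: DERIV_def)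
    moreover have "filterlim h (at 0) sequentially"
      using h0 h by (auto simp: filterlim_at intro!: always_eventually) (metis less_irrefl)
    ultimately show ?thesis by (rule filterlim_compose)
  qed
  then have "(\<lambda>n. (mass (t + h n) x - mass t x) / h n * (2 * t * (t + h n)))
     \<longlonglongrightarrow> mass t x * (order / t + (norm x)\<^sup>2 / 2) * (2 * t * (t + 0))"
    using h0 by (intro tendsto_intros)
  then have "(LINT y|lborel. (norm y)\<^sup>2 * heat t x y)
     \<le> mass t x * (order / t + (norm x)\<^sup>2 / 2) * (2 * t * (t + 0))"
    using le by (intro LIMSEQ_le_const) auto
  also have "\<dots> = mass t x * (2 * order * t + t\<^sup>2 * (norm x)\<^sup>2)"
    using t by (simp add: field_simps power2_eq_square)
  finally show ?thesis .
qed

lemma radial_derivative_le: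
  assumes "norm x \<le> b"
  shows "\<bar>radial_derivative x y\<bar> \<le> (1 + 2 * dunkl_gamma Rp k) * exp (2 * b * norm y)"
proof -
  have b: "0 \<le> b" using assms norm_ge_zero order_trans by blast
  let ?e = "exp (b * norm y)"
  have D: "\<bar>D z y\<bar> \<le> ?e" if "norm z \<le> b" for z
    using kernel_le_exp_norm[of z y] kernel_pos[of z y] mult_right_mono[OF that, of "norm y"]
    by (smt (verit, best) exp_le_cancel_iff norm_ge_zero)
  have e1: "1 \<le> ?e" using b by simp
  have "\<bar>x \<bullet> y\<bar> \<le> b * norm y"
    using Cauchy_Schwarz_ineq2[of x y] mult_right_mono[OF assms, of "norm y"] by simp
  also have "\<dots> \<le> ?e" using exp_ge_add_one_self[of "b * norm y"] by linarith
  finally have 1: "\<bar>(x \<bullet> y) * D x y\<bar> \<le> ?e * ?e"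
    unfolding abs_mult by (intro mult_mono D assms) auto
  have "\<bar>\<Sum>\<beta>\<in>Rp. k \<beta> * (D x y - D (reflection \<beta> x) y)\<bar> \<le> (\<Sum>\<beta>\<in>Rp. k \<beta> * (2 * ?e))"
  proof (rule order_trans[OF sum_abs sum_mono])
    fix \<beta> assume "\<beta> \<in> Rp"
    have "\<bar>D x y - D (reflection \<beta> x) y\<bar> \<le> 2 * ?e"
      using D[OF assms] D[of "reflection \<beta> x"] assms by simp
    then show "\<bar>k \<beta> * (D x y - D (reflection \<beta> x) y)\<bar> \<le> k \<beta> * (2 * ?e)"
      using k_nonneg'[OF \<open>\<beta> \<in> Rp\<close>] by (simp add: abs_mult mult_left_mono)
  qed
  also have "\<dots> = 2 * dunkl_gamma Rp k * ?e" by (simp add: dunkl_gamma_def sum_distrib_left sum_distrib_right mult_ac)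
  also have "\<dots> \<le> 2 * dunkl_gamma Rp k * (?e * ?e)"
    using e1 k_nonneg' by (intro mult_left_mono) (auto simp: dunkl_gamma_def intro!: sum_nonneg)
  finally have "\<bar>radial_derivative x y\<bar> \<le> (1 + 2 * dunkl_gamma Rp k) * (?e * ?e)"
    using 1 unfolding radial_derivative_def by (simp add: algebra_simps)
  then show ?thesis by (simp add: exp_add[symmetric] mult.assoc)
qed

lemma radial_difference_le:
  assumes r: "1 < r" "r \<le> 2"
  shows "\<bar>(D (r *\<^sub>R x) y - D x y) / (r - 1)\<bar> \<le> (1 + 2 * dunkl_gamma Rp k) * exp (4 * norm x * norm y)"
proof -
  obtain \<xi> where \<xi>: "1 < \<xi>" "\<xi> < r"
    "D (r *\<^sub>R x) y - D (1 *\<^sub>R x) y = (r - 1) * (radial_derivative (\<xi> *\<^sub>R x) y / \<xi>)"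
    using MVT2[OF r(1), of "\<lambda>r. D (r *\<^sub>R x) y" "\<lambda>r. radial_derivative (r *\<^sub>R x) y / r"]
      kernel_radial_derivative by fastforce
  then have "\<bar>(D (r *\<^sub>R x) y - D x y) / (r - 1)\<bar> = \<bar>radial_derivative (\<xi> *\<^sub>R x) y\<bar> / \<xi>"
    using r by simp
  also have "\<dots> \<le> \<bar>radial_derivative (\<xi> *\<^sub>R x) y\<bar> / 1"
    using \<xi> by (intro divide_left_mono) auto
  also have "\<dots> \<le> (1 + 2 * dunkl_gamma Rp k) * exp (2 * (2 * norm x) * norm y)"
    unfolding div_by_1 using \<xi> r by (intro radial_derivative_le) (auto intro!: mult_right_mono)
  finally show ?thesis by (simp add: mult.assoc)
qed

text \<open>The reflection terms cancel because the total mass at \<open>x\<close> depends only on \<open>|x|\<close>.\<close>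

lemma radial_heat_integral:
  assumes t: "0 < t"
  shows "(LINT y|lborel. radial_derivative x y * (exp (- (norm y)\<^sup>2 / (2 * t)) * dunkl_weight Rp k y))
    = (LINT y|lborel. (x \<bullet> y) * heat t x y)"
proof -
  have "(\<Sum>\<beta>\<in>Rp. k \<beta> * (heat t x y - heat t (reflection \<beta> x) y))
    = (\<Sum>\<beta>\<in>Rp. k \<beta> * (D x y - D (reflection \<beta> x) y)) * (exp (- (norm y)\<^sup>2 / (2 * t)) * dunkl_weight Rp k y)" for y
    unfolding sum_distrib_right by (rule sum.cong) (simp_all add: heat_def algebra_simps)
  then have "radial_derivative x y * (exp (- (norm y)\<^sup>2 / (2 * t)) * dunkl_weight Rp k y)
    = (x \<bullet> y) * heat t x y - (\<Sum>\<beta>\<in>Rp. k \<beta> * (heat t x y - heat t (reflection \<beta> x) y))" for y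
    by (simp add: radial_derivative_def heat_def left_diff_distrib)
  then have "(LINT y|lborel. radial_derivative x y * (exp (- (norm y)\<^sup>2 / (2 * t)) * dunkl_weight Rp k y))
    = (LINT y|lborel. (x \<bullet> y) * heat t x y)
      - (\<Sum>\<beta>\<in>Rp. k \<beta> * ((LINT y|lborel. heat t x y) - (LINT y|lborel. heat t (reflection \<beta> x) y)))"
    using t by (simp add: integrable_inner_heat heat_integrable)
  then show ?thesis using t by (simp add: heat_mass mass_reflection)
qed

text \<open>Differentiate the mass identity along the ray of \<open>x\<close>, using dominated convergence of the
  difference quotients of the kernel at radius 1.\<close>

lemma first_moment:
  assumes t: "0 < t"
  shows "(LINT y|lborel. (x \<bullet> y) * heat t x y) = mass t x * (t * (norm x)\<^sup>2)"
proof -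
  define r where "r = (\<lambda>n. 1 + inverse (real (Suc n)))"
  have r: "1 < r n" "r n \<le> 2" for n by (auto simp: r_def field_simps)
  have "r \<longlonglongrightarrow> 1"
    unfolding r_def using tendsto_add[OF tendsto_const LIMSEQ_inverse_real_of_nat, of 1] by simp
  then have rlim: "filterlim r (at 1) sequentially"
    using r by (auto simp: filterlim_at intro!: always_eventually) (metis less_irrefl)
  \<comment> \<open>The \<open>x\<close>-independent part of the integrand.\<close>
  define w where "w = (\<lambda>y. exp (- (norm y)\<^sup>2 / (2 * t)) * dunkl_weight Rp k y)"
  have w0: "0 \<le> w y" for y unfolding w_def using weight_nonneg by simp
  have heat_w: "heat t z y = D z y * w y" for z y by (simp add: heat_def w_def)
  have m[measurable]: "(\<lambda>y. D z y * w y) \<in> borel_measurable borel" for z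
    using heat_integrable[OF t, of z] unfolding heat_w[symmetric] by measurable
  define q where "q = (\<lambda>n y. (D (r n *\<^sub>R x) y * w y - D x y * w y) / (r n - 1))"
  have lim: "(\<lambda>n. q n y) \<longlonglongrightarrow> radial_derivative x y * w y" for y
  proof -
    have "((\<lambda>s. (D (s *\<^sub>R x) y - D (1 *\<^sub>R x) y) / (s - 1)) \<longlongrightarrow> radial_derivative x y) (at 1)"
      using kernel_radial_derivative[of 1 x y] by (simp add: has_field_derivative_iff)
    from tendsto_mult_right[OF filterlim_compose[OF this rlim], of "w y"]
    show ?thesis unfolding q_def by (simp add: left_diff_distrib[symmetric])
  qed
  have "(\<lambda>n. LINT y|lborel. q n y) \<longlonglongrightarrow> (LINT y|lborel. radial_derivative x y * w y)"
  proof (rule integral_dominated_convergence)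
    show "integrable lborel (\<lambda>y. (1 + 2 * dunkl_gamma Rp k) * heat_bound t (4 * norm x) y)"
      using t by (intro integrable_mult_right integrable_heat_bound)
    show "(\<lambda>y. radial_derivative x y * w y) \<in> borel_measurable lborel"
      using lim by (rule borel_measurable_LIMSEQ_real) (simp add: q_def)
    show "q n \<in> borel_measurable lborel" for n unfolding q_def by measurable
    show "AE y in lborel. norm (q n y) \<le> (1 + 2 * dunkl_gamma Rp k) * heat_bound t (4 * norm x) y" for n
    proof (rule AE_I2)
      fix y
      have "norm (q n y) = \<bar>(D (r n *\<^sub>R x) y - D x y) / (r n - 1)\<bar> * w y"
        using w0 by (simp add: q_def left_diff_distrib[symmetric] abs_mult)
      also have "\<dots> \<le> (1 + 2 * dunkl_gamma Rp k) * exp (4 * norm x * norm y) * w y"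
        by (intro mult_right_mono radial_difference_le r w0)
      also have "\<dots> \<le> (1 + 2 * dunkl_gamma Rp k) * heat_bound t (4 * norm x) y"
        using gauss_weight_le_heat_bound[of "4 * norm x" y t] k_nonneg'
        by (auto simp: w_def mult.assoc dunkl_gamma_def intro!: mult_left_mono add_nonneg_nonneg sum_nonneg)
      finally show "norm (q n y) \<le> (1 + 2 * dunkl_gamma Rp k) * heat_bound t (4 * norm x) y" .
    qed
  qed (use lim in auto)
  moreover have "(LINT y|lborel. q n y) = (mass t (r n *\<^sub>R x) - mass t (1 *\<^sub>R x)) / (r n - 1)" for n
    using t unfolding q_def heat_w[symmetric] by (simp add: heat_integrable heat_mass)
  moreover have "(\<lambda>n. (mass t (r n *\<^sub>R x) - mass t (1 *\<^sub>R x)) / (r n - 1))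
     \<longlonglongrightarrow> mass t x * (t * (norm x)\<^sup>2)"
    using filterlim_compose[OF mass_ray_derivative[unfolded has_field_derivative_iff] rlim] by simp
  ultimately have "(LINT y|lborel. radial_derivative x y * w y) = mass t x * (t * (norm x)\<^sup>2)"
    using LIMSEQ_unique by simp
  then show ?thesis using radial_heat_integral[OF t, of x] by (simp add: w_def)
qed

lemma integrable_density: "0 < t \<Longrightarrow> integrable lborel (dunkl_density Rp k D t z)"
proof -
  assume t: "0 < t"
  have "dunkl_density Rp k D t z = (\<lambda>y. heat t (z /\<^sub>R t) y / mass t (z /\<^sub>R t))"
    by (intro ext density_eq_heat t)
  then show ?thesis using heat_integrable[OF t] by simp
qed

lemma density_nonneg: "0 < t \<Longrightarrow> 0 \<le> dunkl_density Rp k D t z y"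
  using density_eq_heat[of t z] heat_nonneg mass_pos[of t "z /\<^sub>R t"] by simp

text \<open>The first moment says \<open>E\<^sub>z \<langle>z, X\<^sub>t\<rangle> = |z|\<^sup>2\<close> and the second one \<open>E\<^sub>z |X\<^sub>t|\<^sup>2 \<le> |z|\<^sup>2 + 2 q t\<close>, so the terms of order
  \<open>|z|\<^sup>2\<close> cancel. The bound is uniform in \<open>z\<close>, in particular near all hyperplanes.\<close>

lemma density_second_moment:
  assumes t: "0 < t"
  shows "integrable lborel (\<lambda>y. (norm (y - z))\<^sup>2 * dunkl_density Rp k D t z y)"
    and "(LINT y|lborel. (norm (y - z))\<^sup>2 * dunkl_density Rp k D t z y) \<le> 2 * order * t"
proof -
  define x where "x = z /\<^sub>R t"
  have z: "z = t *\<^sub>R x" using t by (simp add: x_def)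
  note M = mass_pos[OF t, of x]
  have eq: "(norm (y - z))\<^sup>2 * dunkl_density Rp k D t z y
     = ((norm y)\<^sup>2 * heat t x y - 2 * t * ((x \<bullet> y) * heat t x y) + t\<^sup>2 * (norm x)\<^sup>2 * heat t x y) / mass t x" for y
  proof -
    have n: "(norm (y - z))\<^sup>2 = (norm y)\<^sup>2 - 2 * t * (x \<bullet> y) + t\<^sup>2 * (norm x)\<^sup>2"
      unfolding z power2_norm_eq_inner
      by (simp add: inner_diff_left inner_diff_right inner_commute algebra_simps power2_eq_square)
    show ?thesis
      unfolding density_eq_heat[OF t] x_def[symmetric] n
      by (simp only: times_divide_eq_right) (simp add: algebra_simps)
  qed
  note ints = integrable_norm_sq_heat[OF t, of x] integrable_inner_heat[OF t, of x x] heat_integrable[OF t, of x]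
  show "integrable lborel (\<lambda>y. (norm (y - z))\<^sup>2 * dunkl_density Rp k D t z y)"
    unfolding eq using ints by simp
  have "(LINT y|lborel. (norm (y - z))\<^sup>2 * dunkl_density Rp k D t z y)
    = ((LINT y|lborel. (norm y)\<^sup>2 * heat t x y) - 2 * t * (LINT y|lborel. (x \<bullet> y) * heat t x y)
       + t\<^sup>2 * (norm x)\<^sup>2 * (LINT y|lborel. heat t x y)) / mass t x"
    unfolding eq using ints by simp
  also have "\<dots> \<le> (mass t x * (2 * order * t + t\<^sup>2 * (norm x)\<^sup>2) - 2 * t * (mass t x * (t * (norm x)\<^sup>2))
       + t\<^sup>2 * (norm x)\<^sup>2 * mass t x) / mass t x"
    using second_moment_le[OF t, of x] M t
    by (intro divide_right_mono) (auto simp: first_moment heat_mass)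
  also have "\<dots> = 2 * order * t"
    using M by (simp add: field_simps power2_eq_square)
  finally show "(LINT y|lborel. (norm (y - z))\<^sup>2 * dunkl_density Rp k D t z y) \<le> 2 * order * t" .
qed

text \<open>If \<open>\<langle>\<alpha>, y\<rangle>\<close> and \<open>\<langle>\<alpha>, z\<rangle>\<close> do not have the same sign, then \<open>|\<langle>\<alpha>, y - z\<rangle>| \<ge> |\<langle>\<alpha>, z\<rangle>|\<close>; the rest is
  Chebyshev's inequality.\<close>

lemma crossing_probability_le:
  assumes t: "0 < t" and A: "A \<in> sets borel" and z: "\<alpha> \<bullet> z \<noteq> 0"
    and far: "\<And>y. y \<in> A \<Longrightarrow> (\<alpha> \<bullet> z) * (\<alpha> \<bullet> y) \<le> 0"
  shows "(LINT y:A|lborel. dunkl_density Rp k D t z y) \<le> 2 * order * (norm \<alpha>)\<^sup>2 * t / (\<alpha> \<bullet> z)\<^sup>2"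
proof -
  let ?p = "dunkl_density Rp k D t z"
  have le: "indicator A y * ?p y \<le> (norm \<alpha>)\<^sup>2 / (\<alpha> \<bullet> z)\<^sup>2 * ((norm (y - z))\<^sup>2 * ?p y)" for y
  proof (cases "y \<in> A")
    case True
    have "(\<alpha> \<bullet> z)\<^sup>2 \<le> (\<alpha> \<bullet> z)\<^sup>2 + (\<alpha> \<bullet> y)\<^sup>2 - 2 * ((\<alpha> \<bullet> z) * (\<alpha> \<bullet> y))" using far[OF True] by (smt (verit) zero_le_power2)
    also have "\<dots> = (\<alpha> \<bullet> (y - z))\<^sup>2" by (simp add: inner_diff_right power2_eq_square algebra_simps)
    also have "\<dots> \<le> (norm \<alpha>)\<^sup>2 * (norm (y - z))\<^sup>2"
      using Cauchy_Schwarz_ineq[of \<alpha> "y - z"] by (simp add: power2_norm_eq_inner)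
    finally have "1 \<le> (norm \<alpha>)\<^sup>2 / (\<alpha> \<bullet> z)\<^sup>2 * (norm (y - z))\<^sup>2" using z by (simp add: field_simps)
    from mult_right_mono[OF this density_nonneg[OF t, of z y]] show ?thesis using True by (simp add: mult.assoc)
  qed (simp add: density_nonneg[OF t])
  have "(LINT y:A|lborel. ?p y) \<le> (LINT y|lborel. (norm \<alpha>)\<^sup>2 / (\<alpha> \<bullet> z)\<^sup>2 * ((norm (y - z))\<^sup>2 * ?p y))"
    unfolding set_lebesgue_integral_def real_scaleR_def using le A
    by (intro integral_mono integrable_mult_right density_second_moment t integrable_real_mult_indicator
        integrable_density | simp add: mult.commute[of "indicator A _"])+
  also have "\<dots> = (norm \<alpha>)\<^sup>2 / (\<alpha> \<bullet> z)\<^sup>2 * (LINT y|lborel. (norm (y - z))\<^sup>2 * ?p y)"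
    by simp
  also have "\<dots> \<le> (norm \<alpha>)\<^sup>2 / (\<alpha> \<bullet> z)\<^sup>2 * (2 * order * t)"
    by (intro mult_left_mono density_second_moment t) simp
  finally show ?thesis by (simp add: mult_ac)
qed

end

section \<open>The Dunkl process\<close>

locale dunkl_markov = dunkl_kernel_data R Rp k D + prob_space M
  for R Rp :: "'a::euclidean_space set" and k D and M :: "'w measure" +
  fixes X :: "real \<Rightarrow> 'w \<Rightarrow> 'a" and x\<^sub>0 :: 'a
  assumes process: "dunkl_process Rp k D M X"
    and initial: "AE \<omega> in M. X 0 \<omega> = x\<^sub>0"
begin

abbreviation (input) p where "p \<equiv> dunkl_density Rp k D"

lemma cadlag_path: "\<omega> \<in> space M \<Longrightarrow> cadlag (\<lambda>t. X t \<omega>)"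
  using process unfolding dunkl_process_def by blast

lemma measurable_process: "0 \<le> t \<Longrightarrow> X t \<in> borel_measurable M"
  using process unfolding dunkl_process_def markov_process_with_density_def by blast

lemma markov:
  assumes "0 \<le> s" "0 < t" "A \<in> sets borel"
  shows "AE \<omega> in M. real_cond_exp M (natural_filtration M X s) (\<lambda>\<omega>. indicator A (X (s + t) \<omega>)) \<omega>
      = (LINT y:A|lborel. p t (X s \<omega>) y)"
  using process assms unfolding dunkl_process_def markov_process_with_density_def by blast

lemma filtration:
  assumes "0 \<le> s"
  shows "subalgebra M (natural_filtration M X s)" and "X s \<in> borel_measurable (natural_filtration M X s)"
proof -
  let ?G = "\<Union>u\<in>{0..s}. {X u -` A \<inter> space M | A. A \<in> sets borel}"
  have sub: "?G \<subseteq> sets M" using measurable_process by (auto intro!: measurable_sets)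
  then have pow: "?G \<subseteq> Pow (space M)" using sets.space_closed by blast
  have sets: "sets (natural_filtration M X s) = sigma_sets (space M) ?G"
    and space: "space (natural_filtration M X s) = space M"
    unfolding natural_filtration_def using pow by (simp_all add: space_measure_of_conv)
  show "subalgebra M (natural_filtration M X s)"
    unfolding subalgebra_def sets space using sets.sigma_sets_subset[OF sub] by simp
  show "X s \<in> borel_measurable (natural_filtration M X s)"
  proof (rule measurableI)
    fix A :: "'a set" assume "A \<in> sets borel"
    then have "X s -` A \<inter> space M \<in> ?G" using assms by (intro UN_I[of s]) auto
    then show "X s -` A \<inter> space (natural_filtration M X s) \<in> sets (natural_filtration M X s)"
      unfolding sets space by (rule sigma_sets.Basic)
  qed simp
qed

lemma filtration_sigma_finite:
  assumes "0 \<le> s" shows "sigma_finite_subalgebra M (natural_filtration M X s)"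
  by (intro finite_measure_subalgebra_is_sigma_finite finite_measure_subalgebra.intro
      finite_measure_subalgebra_axioms.intro filtration assms finite_measure_axioms)

text \<open>The conditional probability of the whole space is 1; this is the only source of information on
  the integral of the Dunkl kernel, and it is limited to almost every value of \<open>X\<^sub>s\<close>.\<close>

lemma density_total_mass:
  assumes s: "0 \<le> s" and t: "0 < t"
  shows "AE \<omega> in M. (LINT y|lborel. p t (X s \<omega>) y) = 1"
proof -
  interpret sigma_finite_subalgebra M "natural_filtration M X s" by (rule filtration_sigma_finite[OF s])
  have "AE \<omega> in M. real_cond_exp M (natural_filtration M X s) (\<lambda>_. 1) \<omega> = 1"
    by (intro real_cond_exp_F_meas) auto
  moreover have "AE \<omega> in M. real_cond_exp M (natural_filtration M X s) (\<lambda>_. 1) \<omega>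
      = (LINT y|lborel. p t (X s \<omega>) y)"
    using markov[OF s t, of UNIV] by (simp add: set_lebesgue_integral_def)
  ultimately show ?thesis by eventually_elim simp
qed

lemma initial_total_mass:
  assumes t: "0 < t"
  shows "(LINT y|lborel. p t x\<^sub>0 y) = 1"
proof -
  have "AE \<omega> in M. (LINT y|lborel. p t x\<^sub>0 y) = 1"
    using density_total_mass[OF order_refl t] initial by eventually_elim simp
  then show ?thesis by (simp add: AE_const)
qed

text \<open>If the constant vanished, division by 0 would make all densities 0 and contradict the total mass.\<close>

lemma kernel_const_pos: "0 < dunkl_const Rp k"
proof -
  have "0 \<le> dunkl_const Rp k"
    unfolding dunkl_const_def by (intro integral_nonneg_AE AE_I2 mult_nonneg_nonneg weight_nonneg) auto
  moreover have "dunkl_const Rp k \<noteq> 0"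
    using initial_total_mass[of 1] by (auto simp: dunkl_density_def)
  ultimately show ?thesis by simp
qed

lemma law_process:
  assumes t: "0 < t" and A: "A \<in> sets borel"
  shows "measure M {\<omega> \<in> space M. X t \<omega> \<in> A} = (LINT y:A|lborel. p t x\<^sub>0 y)"
proof -
  interpret S: sigma_finite_subalgebra M "natural_filtration M X 0" by (rule filtration_sigma_finite) simp
  let ?f = "\<lambda>\<omega>. indicator A (X t \<omega>) :: real"
  have [measurable]: "X t \<in> borel_measurable M" "A \<in> sets borel" using t A by (auto intro: measurable_process)
  have int: "integrable M ?f"
    by (intro integrable_const_bound[of _ 1] AE_I2) (auto simp: indicator_def)
  have "measure M {\<omega> \<in> space M. X t \<omega> \<in> A} = (LINT \<omega>|M. indicator {\<omega> \<in> space M. X t \<omega> \<in> A} \<omega>)"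
    by simp
  also have "\<dots> = (LINT \<omega>|M. ?f \<omega>)"
    by (intro Bochner_Integration.integral_cong) (auto simp: indicator_def)
  also have "\<dots> = (LINT \<omega>|M. real_cond_exp M (natural_filtration M X 0) ?f \<omega>)"
    using S.real_cond_exp_int(2)[OF int] by simp
  also have "\<dots> = (LINT \<omega>|M. (LINT y:A|lborel. p t x\<^sub>0 y))"
    using markov[OF order_refl t A] initial by (intro integral_cong_AE) auto
  finally show ?thesis by (simp add: prob_space)
qed

text \<open>The bound on the transition probability is used only through an almost sure inequality for the conditional
  expectation, so measurability of \<open>z \<mapsto> \<integral>\<^sub>A p\<^sub>t(z, y) dy\<close> is never at stake.\<close>

lemma transition_bound:
  assumes s: "0 \<le> s" and t: "0 < t" and A: "A \<in> sets borel" and B: "B \<in> sets borel"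
    and g: "\<And>z. z \<in> B \<Longrightarrow> (LINT y:A|lborel. p t z y) \<le> g z"
  shows "emeasure M {\<omega> \<in> space M. X s \<omega> \<in> B \<and> X (s + t) \<omega> \<in> A}
      \<le> (\<integral>\<^sup>+\<omega>. ennreal (indicator B (X s \<omega>) * g (X s \<omega>)) \<partial>M)"
proof -
  let ?F = "natural_filtration M X s"
  interpret S: sigma_finite_subalgebra M ?F by (rule filtration_sigma_finite[OF s])
  have [measurable]: "X s \<in> borel_measurable M" "X (s + t) \<in> borel_measurable M"
    "A \<in> sets borel" "B \<in> sets borel" "X s \<in> borel_measurable ?F"
    using s t A B filtration by (auto intro: measurable_process)
  let ?f = "\<lambda>\<omega>. indicator A (X (s + t) \<omega>) :: real" and ?b = "\<lambda>\<omega>. indicator B (X s \<omega>) :: real"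
  let ?Y = "real_cond_exp M ?F ?f"
  have int: "integrable M (\<lambda>\<omega>. ?b \<omega> * ?f \<omega>)"
    by (intro integrable_const_bound[of _ 1] AE_I2) (auto simp: indicator_def)
  have Y: "AE \<omega> in M. 0 \<le> ?Y \<omega>" by (intro S.real_cond_exp_pos AE_I2) auto
  have intY: "integrable M (\<lambda>\<omega>. ?b \<omega> * ?Y \<omega>)"
    "(LINT \<omega>|M. ?b \<omega> * ?Y \<omega>) = (LINT \<omega>|M. ?b \<omega> * ?f \<omega>)"
    by (rule S.real_cond_exp_intg[OF int]; measurable)+
  have "emeasure M {\<omega> \<in> space M. X s \<omega> \<in> B \<and> X (s + t) \<omega> \<in> A}
      = (\<integral>\<^sup>+\<omega>. indicator {\<omega> \<in> space M. X s \<omega> \<in> B \<and> X (s + t) \<omega> \<in> A} \<omega> \<partial>M)"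
    by (intro nn_integral_indicator[symmetric]) measurable
  also have "\<dots> = (\<integral>\<^sup>+\<omega>. ennreal (?b \<omega> * ?f \<omega>) \<partial>M)"
    by (intro nn_integral_cong) (auto simp: indicator_def)
  also have "\<dots> = ennreal (LINT \<omega>|M. ?b \<omega> * ?f \<omega>)"
    by (intro nn_integral_eq_integral int) auto
  also have "\<dots> = (\<integral>\<^sup>+\<omega>. ennreal (?b \<omega> * ?Y \<omega>) \<partial>M)"
    unfolding intY(2)[symmetric] using Y by (intro nn_integral_eq_integral[symmetric] intY(1)) auto
  also have "\<dots> \<le> (\<integral>\<^sup>+\<omega>. ennreal (?b \<omega> * g (X s \<omega>)) \<partial>M)"
    using markov[OF s t A] by (intro nn_integral_mono_AE) (auto simp: indicator_def intro!: ennreal_leI g)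
  finally show ?thesis .
qed

lemma AE_weight_pos: "AE y in lborel. 0 < dunkl_weight Rp k y"
proof -
  have "AE y in lborel. \<beta> \<bullet> y \<noteq> 0" if "\<beta> \<in> Rp" for \<beta>
  proof -
    have "\<beta> \<noteq> 0" using that Rp_subset root_nonzero by blast
    then have "{y. \<beta> \<bullet> y = 0} \<in> null_sets lebesgue"
      using negligible_hyperplane[of \<beta> 0] by (simp add: negligible_iff_null_sets)
    moreover have "{y. \<beta> \<bullet> y = 0} \<in> sets lborel" by measurable
    ultimately have "{y. \<beta> \<bullet> y = 0} \<in> null_sets lborel" by (simp add: null_sets_completion_iff)
    then show ?thesis by (rule AE_I'[where N = "{y. \<beta> \<bullet> y = 0}"]) auto
  qed
  then have "AE y in lborel. \<forall>\<beta>\<in>Rp. \<beta> \<bullet> y \<noteq> 0" using finite_Rp by (intro AE_finite_allI)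
  then show ?thesis
    by eventually_elim (auto simp: dunkl_weight_def intro!: prod_pos)
qed

lemma total_mass_heat:
  assumes t: "0 < t" and z: "(LINT y|lborel. p t z y) = 1"
  shows "integrable lborel (heat t (z /\<^sub>R t))" and "(LINT y|lborel. heat t (z /\<^sub>R t) y) = mass t (z /\<^sub>R t)"
proof -
  have eq: "p t z = (\<lambda>y. heat t (z /\<^sub>R t) y / mass t (z /\<^sub>R t))" by (intro ext density_eq_heat t)
  have m: "mass t (z /\<^sub>R t) \<noteq> 0" using kernel_const_pos t by (simp add: mass_def)
  have "(LINT y|lborel. heat t (z /\<^sub>R t) y) / mass t (z /\<^sub>R t) = 1"
    using z unfolding eq by simp
  then show "(LINT y|lborel. heat t (z /\<^sub>R t) y) = mass t (z /\<^sub>R t)" using m by simp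
  then show "integrable lborel (heat t (z /\<^sub>R t))" using m not_integrable_integral_eq by force
qed

text \<open>The law of \<open>X\<^sub>1\<close> has a density that is positive almost everywhere, so it charges every ball.\<close>

lemma total_mass_dense:
  assumes t: "0 < t" and e: "0 < e"
  shows "\<exists>z\<in>ball z\<^sub>0 e. (LINT y|lborel. p t z y) = 1"
proof (rule ccontr)
  assume none: "\<not> ?thesis"
  have "AE \<omega> in M. X 1 \<omega> \<notin> ball z\<^sub>0 e"
    using density_total_mass[OF _ t, of 1] none by auto
  then have "measure M {\<omega> \<in> space M. X 1 \<omega> \<in> ball z\<^sub>0 e} = 0"
    by (intro prob_eq_0_AE) auto
  then have zero: "(LINT y|lborel. indicator (ball z\<^sub>0 e) y * p 1 x\<^sub>0 y) = 0"
    using law_process[of 1 "ball z\<^sub>0 e"] by (simp add: set_lebesgue_integral_def)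
  have pint: "integrable lborel (p 1 x\<^sub>0)"
    using initial_total_mass[of 1] not_integrable_integral_eq by force
  have p0: "0 \<le> p 1 x\<^sub>0 y" for y
    using kernel_const_pos weight_nonneg kernel_pos[of "x\<^sub>0 /\<^sub>R sqrt 1" "y /\<^sub>R sqrt 1"]
    by (simp add: dunkl_density_def)
  have "integrable lborel (\<lambda>y. indicator (ball z\<^sub>0 e) y * p 1 x\<^sub>0 y)"
    using integrable_real_mult_indicator[OF _ pint, of "ball z\<^sub>0 e"] by (simp add: mult.commute)
  then have "AE y in lborel. indicator (ball z\<^sub>0 e) y * p 1 x\<^sub>0 y = 0"
    using zero p0 by (subst (asm) integral_nonneg_eq_0_iff_AE) auto
  moreover have "AE y in lborel. 0 < p 1 x\<^sub>0 y"
    using AE_weight_pos by eventually_elim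
      (use kernel_const_pos kernel_pos in \<open>simp add: dunkl_density_def\<close>)
  ultimately have "AE y in lborel. y \<notin> ball z\<^sub>0 e"
    by eventually_elim (auto simp: indicator_def)
  then have "ball z\<^sub>0 e \<in> null_sets lborel" by (simp add: AE_iff_null_sets)
  then have "negligible (ball z\<^sub>0 e)" by (simp add: negligible_iff_null_sets null_sets_completionI)
  then show False using open_not_negligible[OF open_ball, of z\<^sub>0 e] e by auto
qed

text \<open>Continuity of both sides extends the mass identity from the dense set of good points to all of
  them, together with integrability: an integral different from 0 is the integral of an integrable
  function.\<close>

sublocale dunkl_normalised R Rp k D
proof
  show "0 < dunkl_const Rp k" by (rule kernel_const_pos)
  have both: "integrable lborel (heat t x) \<and> (LINT y|lborel. heat t x y) = mass t x" if t: "0 < t" for t x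
  proof -
    have "\<forall>n. \<exists>z\<in>ball (t *\<^sub>R x) (inverse (real (Suc n))). (LINT y|lborel. p t z y) = 1"
      using total_mass_dense[OF t] by simp
    then obtain z where z: "\<And>n. dist (t *\<^sub>R x) (z n) < inverse (real (Suc n))"
      "\<And>n. (LINT y|lborel. p t (z n) y) = 1" by (metis mem_ball)
    have "z \<longlonglongrightarrow> t *\<^sub>R x"
      by (rule metric_LIMSEQ_I) (metis (no_types, lifting) LIMSEQ_inverse_real_of_nat dist_commute order_tendstoD(2)
          eventually_sequentially less_trans z(1))
    then have lim: "(\<lambda>n. z n /\<^sub>R t) \<longlonglongrightarrow> x"
      using tendsto_scaleR[OF tendsto_const, of z "t *\<^sub>R x" sequentially "inverse t"] t by simp
    have m: "heat t (z n /\<^sub>R t) \<in> borel_measurable lborel" for n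
      using total_mass_heat(1)[OF t z(2)] by (rule borel_measurable_integrable)
    have I: "(\<lambda>n. LINT y|lborel. heat t (z n /\<^sub>R t) y) \<longlonglongrightarrow> (LINT y|lborel. heat t x y)"
      by (rule heat_integral_continuous(2)[OF t lim m])
    have "(\<lambda>n. mass t (z n /\<^sub>R t)) \<longlonglongrightarrow> mass t x"
      unfolding mass_def by (intro tendsto_intros lim) simp
    then have eq: "(LINT y|lborel. heat t x y) = mass t x"
      using LIMSEQ_unique[OF I] total_mass_heat(2)[OF t z(2)] by simp
    moreover have "mass t x \<noteq> 0" using kernel_const_pos t by (simp add: mass_def)
    ultimately show ?thesis using not_integrable_integral_eq by force
  qed
  then show "integrable lborel (heat t x)" "(LINT y|lborel. heat t x y) = mass t x" if "0 < t" for t x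
    using that by blast+
qed

lemma law_process_nn:
  assumes t: "0 < t" and [measurable]: "f \<in> borel_measurable borel"
  shows "(\<integral>\<^sup>+\<omega>. f (X t \<omega>) \<partial>M) = (\<integral>\<^sup>+y. ennreal (p t x\<^sub>0 y) * f y \<partial>lborel)"
proof -
  have [measurable]: "X t \<in> borel_measurable M" using t by (intro measurable_process) simp
  note pint = integrable_density[OF t, of x\<^sub>0]
  have [measurable]: "p t x\<^sub>0 \<in> borel_measurable borel" using borel_measurable_integrable[OF pint] by simp
  have "distr M borel (X t) = density lborel (\<lambda>y. ennreal (p t x\<^sub>0 y))"
  proof (rule measure_eqI)
    fix A assume "A \<in> sets (distr M borel (X t))"
    then have A[measurable]: "A \<in> sets borel" by simp
    have "emeasure (distr M borel (X t)) A = ennreal (measure M {\<omega> \<in> space M. X t \<omega> \<in> A})"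
      by (simp add: emeasure_distr emeasure_eq_measure vimage_def Int_def conj_commute)
    also have "\<dots> = ennreal (LINT y|lborel. indicator A y * p t x\<^sub>0 y)"
      using law_process[OF t A] by (simp add: set_lebesgue_integral_def)
    also have "\<dots> = (\<integral>\<^sup>+y. ennreal (indicator A y * p t x\<^sub>0 y) \<partial>lborel)"
      using density_nonneg[OF t] integrable_real_mult_indicator[OF _ pint, of A]
      by (intro nn_integral_eq_integral[symmetric]) (auto simp: mult.commute)
    also have "\<dots> = emeasure (density lborel (\<lambda>y. ennreal (p t x\<^sub>0 y))) A"
      by (subst emeasure_density) (auto intro!: nn_integral_cong simp: indicator_def)
    finally show "emeasure (distr M borel (X t)) A = emeasure (density lborel (\<lambda>y. ennreal (p t x\<^sub>0 y))) A" .
  qed simp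
  moreover have "(\<integral>\<^sup>+\<omega>. f (X t \<omega>) \<partial>M) = (\<integral>\<^sup>+y. f y \<partial>distr M borel (X t))"
    by (intro nn_integral_distr[symmetric]) auto
  ultimately show ?thesis by (simp add: nn_integral_density)
qed

text \<open>The two directions of the sign change are treated separately: for each, the starting half-space and the
  target half-space are fixed sets, as the Markov property requires.\<close>

lemma sign_change_probability:
  assumes s: "0 \<le> s" and t: "0 < t"
  shows "emeasure M {\<omega> \<in> space M. (\<alpha> \<bullet> X s \<omega>) * (\<alpha> \<bullet> X (s + t) \<omega>) < 0}
    \<le> (\<integral>\<^sup>+\<omega>. ennreal (2 * order * (norm \<alpha>)\<^sup>2 * t / (\<alpha> \<bullet> X s \<omega>)\<^sup>2) \<partial>M)"
proof -
  have [measurable]: "X s \<in> borel_measurable M" "X (s + t) \<in> borel_measurable M"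
    using s t by (auto intro: measurable_process)
  define g where "g = (\<lambda>z. 2 * order * (norm \<alpha>)\<^sup>2 * t / (\<alpha> \<bullet> z)\<^sup>2)"
  have [measurable]: "g \<in> borel_measurable borel" unfolding g_def by measurable
  have "0 \<le> order" using k_nonneg' by (auto simp: dunkl_gamma_def intro!: add_nonneg_nonneg sum_nonneg)
  then have g0: "0 \<le> g z" for z using t unfolding g_def by simp
  let ?P = "{z. 0 < \<alpha> \<bullet> z}" and ?N = "{z. \<alpha> \<bullet> z < 0}"
  have b: "emeasure M {\<omega> \<in> space M. X s \<omega> \<in> B \<and> X (s + t) \<omega> \<in> A}
      \<le> (\<integral>\<^sup>+\<omega>. ennreal (indicator B (X s \<omega>) * g (X s \<omega>)) \<partial>M)"
    if "(A = ?N \<and> B = ?P) \<or> (A = ?P \<and> B = ?N)" for A B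
    using that t unfolding g_def
    by (intro transition_bound s crossing_probability_le) (auto simp: mult_le_0_iff)
  have "emeasure M {\<omega> \<in> space M. (\<alpha> \<bullet> X s \<omega>) * (\<alpha> \<bullet> X (s + t) \<omega>) < 0}
    = emeasure M ({\<omega> \<in> space M. X s \<omega> \<in> ?P \<and> X (s + t) \<omega> \<in> ?N} \<union> {\<omega> \<in> space M. X s \<omega> \<in> ?N \<and> X (s + t) \<omega> \<in> ?P})"
    by (intro arg_cong[where f = "emeasure M"]) (auto simp: mult_less_0_iff)
  also have "\<dots> \<le> emeasure M {\<omega> \<in> space M. X s \<omega> \<in> ?P \<and> X (s + t) \<omega> \<in> ?N}
     + emeasure M {\<omega> \<in> space M. X s \<omega> \<in> ?N \<and> X (s + t) \<omega> \<in> ?P}"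
    by (intro emeasure_subadditive) measurable
  also have "\<dots> \<le> (\<integral>\<^sup>+\<omega>. ennreal (indicator ?P (X s \<omega>) * g (X s \<omega>)) \<partial>M)
     + (\<integral>\<^sup>+\<omega>. ennreal (indicator ?N (X s \<omega>) * g (X s \<omega>)) \<partial>M)"
    by (intro add_mono b) auto
  also have "\<dots> = (\<integral>\<^sup>+\<omega>. ennreal (indicator ?P (X s \<omega>) * g (X s \<omega>)) + ennreal (indicator ?N (X s \<omega>) * g (X s \<omega>)) \<partial>M)"
    by (intro nn_integral_add[symmetric]) measurable
  also have "\<dots> \<le> (\<integral>\<^sup>+\<omega>. ennreal (g (X s \<omega>)) \<partial>M)"
    using g0 by (intro nn_integral_mono) (auto simp: indicator_def)
  finally show ?thesis unfolding g_def .
qed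

end

section \<open>Inverse square moments\<close>

context dunkl_markov
begin

text \<open>With \<open>u\<close> the image maximising \<open>\<langle>u, y\<rangle>\<close>, the kernel bound completes the square in the exponent,
  as \<open>|u| = |x\<^sub>0|\<close>.\<close>

lemma density_le_gaussian:
  assumes s: "0 < s"
  shows "\<exists>u\<in>mirror_images R x\<^sub>0. p s x\<^sub>0 y
    \<le> 1 / dunkl_const Rp k * s powr (- order) * exp (- (norm (u - y))\<^sup>2 / (2 * s)) * dunkl_weight Rp k y"
proof -
  let ?I = "mirror_images R x\<^sub>0"
  have "Max ((\<lambda>u. u \<bullet> y) ` ?I) \<in> (\<lambda>u. u \<bullet> y) ` ?I"
    using finite_images mirror_images.start by (intro Max_in) auto
  then obtain u where u: "u \<in> ?I" "Max ((\<lambda>u. u \<bullet> y) ` ?I) = u \<bullet> y" by auto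
  have max: "v \<bullet> y \<le> u \<bullet> y" if "v \<in> ?I" for v
    using Max_ge[OF finite_imageI[OF finite_images]] that u(2) by (metis imageI)
  have "D (x\<^sub>0 /\<^sub>R sqrt s) (y /\<^sub>R sqrt s) \<le> exp (u \<bullet> y / s)"
  proof (rule kernel_le_exp[where U = "(\<lambda>v. v /\<^sub>R sqrt s) ` ?I"])
    fix v assume "v \<in> (\<lambda>v. v /\<^sub>R sqrt s) ` ?I"
    then obtain v' where v': "v' \<in> ?I" "v = v' /\<^sub>R sqrt s" by auto
    then have "v \<bullet> (y /\<^sub>R sqrt s) = (v' \<bullet> y) / s"
      using s by (simp add: field_simps)
    then show "v \<bullet> (y /\<^sub>R sqrt s) \<le> u \<bullet> y / s"
      using max[OF v'(1)] s by (simp add: divide_right_mono)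
  qed (auto simp: finite_images mirror_images.start reflection_scaleR images_closed)
  moreover have "exp (- ((norm x\<^sub>0)\<^sup>2 + (norm y)\<^sup>2) / (2 * s)) * exp (u \<bullet> y / s)
      = exp (- (norm (u - y))\<^sup>2 / (2 * s))"
  proof -
    have "(norm (u - y))\<^sup>2 = (norm x\<^sub>0)\<^sup>2 + (norm y)\<^sup>2 - 2 * (u \<bullet> y)"
      using norm_mirror_images[OF u(1)] dot_norm_neg[of u y] by simp
    then have "- (norm (u - y))\<^sup>2 / (2 * s) = - ((norm x\<^sub>0)\<^sup>2 + (norm y)\<^sup>2) / (2 * s) + u \<bullet> y / s"
      using s by (simp add: add_divide_distrib diff_divide_distrib)
    then show ?thesis by (simp only: exp_add)
  qed
  ultimately have le: "exp (- ((norm x\<^sub>0)\<^sup>2 + (norm y)\<^sup>2) / (2 * s)) * D (x\<^sub>0 /\<^sub>R sqrt s) (y /\<^sub>R sqrt s)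
     \<le> exp (- (norm (u - y))\<^sup>2 / (2 * s))"
    by (metis exp_ge_zero mult_left_mono)
  have "p s x\<^sub>0 y = (1 / dunkl_const Rp k * s powr (- order) * dunkl_weight Rp k y) *
      (exp (- ((norm x\<^sub>0)\<^sup>2 + (norm y)\<^sup>2) / (2 * s)) * D (x\<^sub>0 /\<^sub>R sqrt s) (y /\<^sub>R sqrt s))"
    by (simp only: dunkl_density_def powr_minus) (simp add: field_simps)
  also have "\<dots> \<le> (1 / dunkl_const Rp k * s powr (- order) * dunkl_weight Rp k y) * exp (- (norm (u - y))\<^sup>2 / (2 * s))"
    using const_pos weight_nonneg by (intro mult_left_mono le mult_nonneg_nonneg) auto
  finally show ?thesis using u(1) by (auto simp: mult_ac)
qed

text \<open>Only the factor of the root \<open>\<alpha>\<close> in the weight is compared with the singularity.\<close>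

lemma weight_over_square_le:
  assumes \<alpha>: "\<alpha> \<in> Rp"
  shows "dunkl_weight Rp k y / (\<alpha> \<bullet> y)\<^sup>2 \<le> \<bar>\<alpha> \<bullet> y\<bar> powr (2 * k \<alpha> - 2) * exp (growth * norm y)"
proof (cases "\<alpha> \<bullet> y = 0")
  case False
  have "dunkl_weight Rp k y = \<bar>\<alpha> \<bullet> y\<bar> powr (2 * k \<alpha>) * (\<Prod>\<beta>\<in>Rp - {\<alpha>}. \<bar>\<beta> \<bullet> y\<bar> powr (2 * k \<beta>))"
    unfolding dunkl_weight_def by (rule prod.remove[OF finite_Rp \<alpha>])
  moreover have "\<bar>\<alpha> \<bullet> y\<bar> powr (2 * k \<alpha> - 2) = \<bar>\<alpha> \<bullet> y\<bar> powr (2 * k \<alpha>) / (\<alpha> \<bullet> y)\<^sup>2"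
    using False by (simp add: powr_diff)
  ultimately have "dunkl_weight Rp k y / (\<alpha> \<bullet> y)\<^sup>2
     = \<bar>\<alpha> \<bullet> y\<bar> powr (2 * k \<alpha> - 2) * (\<Prod>\<beta>\<in>Rp - {\<alpha>}. \<bar>\<beta> \<bullet> y\<bar> powr (2 * k \<beta>))"
    by simp
  also have "\<dots> \<le> \<bar>\<alpha> \<bullet> y\<bar> powr (2 * k \<alpha> - 2) * exp (growth * norm y)"
    by (intro mult_left_mono partial_weight_le_exp) auto
  finally show ?thesis .
qed simp

text \<open>Where \<open>|\<langle>\<alpha>, y\<rangle>| \<ge> \<delta>\<close>, the integrand is at most \<open>\<delta>\<^sup>-\<^sup>2\<close> times the density. On the remaining slab all
  images of the initial point are at distance at least \<open>\<rho> = \<delta> / |\<alpha>|\<close>, so the density is dominated,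
  uniformly in \<open>s\<close>, by a Gaussian times the weight, and the weight divided by \<open>\<langle>\<alpha>, y\<rangle>\<^sup>2\<close> is
  integrable there since \<open>2 k(\<alpha>) - 2 > -1\<close>.\<close>

lemma inverse_square_bounded:
  assumes \<alpha>: "\<alpha> \<in> Rp" and half: "1 / 2 < k \<alpha>" and T: "0 < T"
    and away: "\<And>u. u \<in> mirror_images R x\<^sub>0 \<Longrightarrow> \<alpha> \<bullet> u \<noteq> 0"
  shows "\<exists>C<\<infinity>. \<forall>s. 0 < s \<longrightarrow> s \<le> T \<longrightarrow> (\<integral>\<^sup>+\<omega>. ennreal (1 / (\<alpha> \<bullet> X s \<omega>)\<^sup>2) \<partial>M) \<le> C"
proof -
  let ?I = "mirror_images R x\<^sub>0"
  have \<alpha>0: "\<alpha> \<noteq> 0" using \<alpha> Rp_subset root_nonzero by blast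
  obtain \<delta> where \<delta>: "0 < \<delta>" "\<delta> \<le> 1" "\<And>u. u \<in> ?I \<Longrightarrow> \<delta> \<le> \<bar>\<alpha> \<bullet> u\<bar> / 2"
  proof (rule finite_positive_lower_bound[of "(\<lambda>u. \<bar>\<alpha> \<bullet> u\<bar> / 2) ` ?I"])
    show "finite ((\<lambda>u. \<bar>\<alpha> \<bullet> u\<bar> / 2) ` ?I)" by (intro finite_imageI finite_images)
    show "0 < a" if "a \<in> (\<lambda>u. \<bar>\<alpha> \<bullet> u\<bar> / 2) ` ?I" for a using that away by auto
  qed (use that in blast)
  define \<rho> where "\<rho> = \<delta> / norm \<alpha>"
  have \<rho>: "0 < \<rho>" using \<delta> \<alpha>0 by (simp add: \<rho>_def)
  define q where "q = dunkl_gamma Rp k + real DIM('a) / 2"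
  have "0 \<le> dunkl_gamma Rp k" using k_nonneg' by (auto simp: dunkl_gamma_def intro!: sum_nonneg)
  then have q: "0 < q" by (simp add: q_def add_nonneg_pos)
  define e where "e = 1 / (8 * T)"
  have e: "0 < e" using T by (simp add: e_def)
  define K where "K = 1 / dunkl_const Rp k * (\<rho>\<^sup>2 / 4 / q) powr (- q) * exp ((norm x\<^sub>0)\<^sup>2 / (4 * T))
    * exp (growth\<^sup>2 / (2 * e))"
  have K: "0 \<le> K" using const_pos by (simp add: K_def)
  define \<phi> where "\<phi> = (\<lambda>y. \<bar>\<alpha> \<bullet> y\<bar> powr (2 * k \<alpha> - 2) * indicator {-1..1} (\<alpha> \<bullet> y) * exp (- (e / 2) * (norm y)\<^sup>2))"
  have [measurable]: "\<phi> \<in> borel_measurable borel" unfolding \<phi>_def by measurable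
  have \<phi>0: "0 \<le> \<phi> y" for y by (simp add: \<phi>_def)
  have key: "p s x\<^sub>0 y * (1 / (\<alpha> \<bullet> y)\<^sup>2) \<le> 1 / \<delta>\<^sup>2 * p s x\<^sub>0 y + K * \<phi> y" if s: "0 < s" "s \<le> T" for s y
  proof (cases "\<delta> \<le> \<bar>\<alpha> \<bullet> y\<bar>")
    case True
    then have "\<delta>\<^sup>2 \<le> (\<alpha> \<bullet> y)\<^sup>2" using \<delta>(1) by (metis abs_le_square_iff abs_of_pos)
    then have "1 / (\<alpha> \<bullet> y)\<^sup>2 \<le> 1 / \<delta>\<^sup>2" using \<delta>(1) by (intro divide_left_mono) (auto simp: zero_less_mult_iff)
    then have "p s x\<^sub>0 y * (1 / (\<alpha> \<bullet> y)\<^sup>2) \<le> p s x\<^sub>0 y * (1 / \<delta>\<^sup>2)"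
      by (intro mult_left_mono density_nonneg s)
    then show ?thesis using mult_nonneg_nonneg[OF K \<phi>0, of y] by (simp add: mult.commute)
  next
    case False
    obtain u where u: "u \<in> ?I" and p: "p s x\<^sub>0 y
      \<le> 1 / dunkl_const Rp k * s powr (- q) * exp (- (norm (u - y))\<^sup>2 / (2 * s)) * dunkl_weight Rp k y"
      using density_le_gaussian[OF s(1)] unfolding q_def by blast
    have "\<delta> \<le> \<bar>\<alpha> \<bullet> (u - y)\<bar>" using \<delta>(3)[OF u] False by (simp add: inner_diff_right)
    also have "\<dots> \<le> norm \<alpha> * norm (u - y)" by (rule Cauchy_Schwarz_ineq2)
    finally have "\<rho> \<le> norm (u - y)" using \<alpha>0 by (simp add: \<rho>_def field_simps)
    then have sq: "\<rho>\<^sup>2 \<le> (norm (u - y))\<^sup>2" using \<rho> by (intro power_mono) auto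
    \<comment> \<open>Half of the Gaussian exponent absorbs the power of \<open>s\<close>, the other half gives decay in \<open>y\<close>.\<close>
    have "- (norm (u - y))\<^sup>2 / (2 * s) \<le> - (\<rho>\<^sup>2 / 4) / s + (norm x\<^sub>0)\<^sup>2 / (4 * T) - e * (norm y)\<^sup>2"
    proof -
      have "(norm y)\<^sup>2 / 2 - (norm x\<^sub>0)\<^sup>2 \<le> (norm (u - y))\<^sup>2"
        using norm_shift_lower[of y "- u"] norm_mirror_images[OF u] by (simp add: norm_minus_commute)
      then have "((norm y)\<^sup>2 / 2 - (norm x\<^sub>0)\<^sup>2) / (4 * T) \<le> (norm (u - y))\<^sup>2 / (4 * T)"
        using T by (intro divide_right_mono) auto
      also have "\<dots> \<le> (norm (u - y))\<^sup>2 / (4 * s)" using s by (intro divide_left_mono) auto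
      finally have 1: "e * (norm y)\<^sup>2 - (norm x\<^sub>0)\<^sup>2 / (4 * T) \<le> (norm (u - y))\<^sup>2 / (4 * s)"
        by (simp add: e_def diff_divide_distrib)
      have 2: "(\<rho>\<^sup>2 / 4) / s \<le> (norm (u - y))\<^sup>2 / (4 * s)"
        using sq s by (simp add: divide_right_mono)
      have 3: "(norm (u - y))\<^sup>2 / (2 * s) = (norm (u - y))\<^sup>2 / (4 * s) + (norm (u - y))\<^sup>2 / (4 * s)"
        by simp
      show ?thesis unfolding minus_divide_left[symmetric] using 1 2 3 by linarith
    qed
    then have "exp (- (norm (u - y))\<^sup>2 / (2 * s))
       \<le> exp (- (\<rho>\<^sup>2 / 4) / s) * exp ((norm x\<^sub>0)\<^sup>2 / (4 * T)) * exp (- e * (norm y)\<^sup>2)"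
      by (simp add: exp_add[symmetric])
    then have "s powr (- q) * exp (- (norm (u - y))\<^sup>2 / (2 * s))
       \<le> s powr (- q) * (exp (- (\<rho>\<^sup>2 / 4) / s) * exp ((norm x\<^sub>0)\<^sup>2 / (4 * T)) * exp (- e * (norm y)\<^sup>2))"
      by (intro mult_left_mono) auto
    also have "\<dots> = s powr (- q) * exp (- (\<rho>\<^sup>2 / 4) / s) * (exp ((norm x\<^sub>0)\<^sup>2 / (4 * T)) * exp (- e * (norm y)\<^sup>2))"
      by (simp only: mult.assoc)
    also have "\<dots> \<le> (\<rho>\<^sup>2 / 4 / q) powr (- q) * (exp ((norm x\<^sub>0)\<^sup>2 / (4 * T)) * exp (- e * (norm y)\<^sup>2))"
      using \<rho> q s by (intro mult_right_mono powr_exp_le) auto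
    finally have G: "s powr (- q) * exp (- (norm (u - y))\<^sup>2 / (2 * s))
       \<le> (\<rho>\<^sup>2 / 4 / q) powr (- q) * exp ((norm x\<^sub>0)\<^sup>2 / (4 * T)) * exp (- e * (norm y)\<^sup>2)"
      by (simp only: mult.assoc)
    have lin: "exp (- e * (norm y)\<^sup>2) * exp (growth * norm y) \<le> exp (growth\<^sup>2 / (2 * e)) * exp (- (e / 2) * (norm y)\<^sup>2)"
      using linear_le_quadratic[OF e, of growth "norm y"] by (simp add: exp_add[symmetric])
    have ind: "indicator {-1..1} (\<alpha> \<bullet> y) = (1::real)" using False \<delta>(2) by (auto simp: indicator_def)
    have "p s x\<^sub>0 y * (1 / (\<alpha> \<bullet> y)\<^sup>2)
      \<le> 1 / dunkl_const Rp k * s powr (- q) * exp (- (norm (u - y))\<^sup>2 / (2 * s)) * dunkl_weight Rp k y * (1 / (\<alpha> \<bullet> y)\<^sup>2)"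
      by (intro mult_right_mono p) auto
    also have "\<dots> = 1 / dunkl_const Rp k * (s powr (- q) * exp (- (norm (u - y))\<^sup>2 / (2 * s))) * (dunkl_weight Rp k y / (\<alpha> \<bullet> y)\<^sup>2)"
      by simp
    also have "\<dots> \<le> 1 / dunkl_const Rp k * ((\<rho>\<^sup>2 / 4 / q) powr (- q) * exp ((norm x\<^sub>0)\<^sup>2 / (4 * T)) * exp (- e * (norm y)\<^sup>2))
        * (\<bar>\<alpha> \<bullet> y\<bar> powr (2 * k \<alpha> - 2) * exp (growth * norm y))"
      using const_pos weight_nonneg by (intro mult_mono weight_over_square_le \<alpha> mult_left_mono G) auto
    also have "\<dots> = 1 / dunkl_const Rp k * (\<rho>\<^sup>2 / 4 / q) powr (- q) * exp ((norm x\<^sub>0)\<^sup>2 / (4 * T))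
        * \<bar>\<alpha> \<bullet> y\<bar> powr (2 * k \<alpha> - 2) * (exp (- e * (norm y)\<^sup>2) * exp (growth * norm y))"
      by (simp only: mult_ac)
    also have "\<dots> \<le> 1 / dunkl_const Rp k * (\<rho>\<^sup>2 / 4 / q) powr (- q) * exp ((norm x\<^sub>0)\<^sup>2 / (4 * T))
        * \<bar>\<alpha> \<bullet> y\<bar> powr (2 * k \<alpha> - 2) * (exp (growth\<^sup>2 / (2 * e)) * exp (- (e / 2) * (norm y)\<^sup>2))"
      using const_pos by (intro mult_left_mono lin) auto
    also have "\<dots> = K * \<phi> y" unfolding K_def \<phi>_def ind by (simp only: mult_ac mult_1_left)
    finally show ?thesis using density_nonneg[OF s(1), of x\<^sub>0 y] \<delta>(1) by (smt (verit, best) zero_le_divide_1_iff zero_le_power2 mult_nonneg_nonneg)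
  qed
  define J where "J = (\<integral>\<^sup>+y. ennreal (\<phi> y) \<partial>lborel)"
  have "J < \<infinity>"
    unfolding J_def \<phi>_def using half e \<alpha>0 by (intro nn_integral_slab_gaussian) auto
  define C where "C = ennreal (1 / \<delta>\<^sup>2) + ennreal K * J"
  have "C < \<infinity>" using \<open>J < \<infinity>\<close> by (simp add: C_def ennreal_mult_less_top)
  moreover have "(\<integral>\<^sup>+\<omega>. ennreal (1 / (\<alpha> \<bullet> X s \<omega>)\<^sup>2) \<partial>M) \<le> C" if s: "0 < s" "s \<le> T" for s
  proof -
    note pint = integrable_density[OF s(1), of x\<^sub>0]
    have [measurable]: "p s x\<^sub>0 \<in> borel_measurable borel" using borel_measurable_integrable[OF pint] by simp
    have "(\<integral>\<^sup>+\<omega>. ennreal (1 / (\<alpha> \<bullet> X s \<omega>)\<^sup>2) \<partial>M) = (\<integral>\<^sup>+y. ennreal (p s x\<^sub>0 y) * ennreal (1 / (\<alpha> \<bullet> y)\<^sup>2) \<partial>lborel)"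
      by (rule law_process_nn[OF s(1)]) measurable
    also have "\<dots> \<le> (\<integral>\<^sup>+y. ennreal (1 / \<delta>\<^sup>2) * ennreal (p s x\<^sub>0 y) + ennreal K * ennreal (\<phi> y) \<partial>lborel)"
      using key[OF s] density_nonneg[OF s(1)] K \<phi>0
      by (intro nn_integral_mono)
         (simp add: ennreal_mult'[symmetric] ennreal_plus[symmetric] ennreal_leI del: ennreal_plus)
    also have "\<dots> = ennreal (1 / \<delta>\<^sup>2) * (\<integral>\<^sup>+y. ennreal (p s x\<^sub>0 y) \<partial>lborel) + ennreal K * J"
      unfolding J_def by (subst nn_integral_add) (auto simp: nn_integral_cmult)
    also have "(\<integral>\<^sup>+y. ennreal (p s x\<^sub>0 y) \<partial>lborel) = 1"
      using nn_integral_eq_integral[OF pint] density_nonneg[OF s(1)] initial_total_mass[OF s(1)] by simp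
    finally show ?thesis by (simp add: C_def)
  qed
  ultimately show ?thesis by blast
qed

end

section \<open>Counting jumps by sign changes\<close>

definition sign_changes :: "(real \<Rightarrow> real) \<Rightarrow> real \<Rightarrow> nat \<Rightarrow> nat" where
  "sign_changes f t n = card {i. i < n \<and> f (real i * (t / n)) * f (real i * (t / n) + t / n) < 0}"

text \<open>Around each \<open>s \<in> F\<close> the function has opposite strict signs on the left and, including \<open>s\<close> itself, on the
  right. Once the mesh is finer than these neighbourhoods and than the gaps of \<open>F\<close>, the half-open cells
  \<open>(i h, (i + 1) h]\<close> that contain the points of \<open>F\<close> are distinct and each of them shows a sign change.\<close>

lemma sign_changes_detect_jumps:
  fixes f l :: "real \<Rightarrow> real"
  assumes fin: "finite F" and F: "F \<subseteq> {0<..t}" and t: "0 < t"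
    and left: "\<And>s. s \<in> F \<Longrightarrow> (f \<longlongrightarrow> l s) (at_left s)"
    and right: "\<And>s. s \<in> F \<Longrightarrow> (f \<longlongrightarrow> f s) (at_right s)"
    and jump: "\<And>s. s \<in> F \<Longrightarrow> l s * f s < 0"
  shows "\<forall>\<^sub>F n in sequentially. card F \<le> sign_changes f t n"
proof -
  have "\<exists>d>0. \<forall>y z. s - d < y \<longrightarrow> y < s \<longrightarrow> s \<le> z \<longrightarrow> z < s + d \<longrightarrow> f y * f z < 0" if s: "s \<in> F" for s
  proof -
    have fs: "l s \<noteq> 0" "f s \<noteq> 0" using jump[OF s] by auto
    have "0 < l s * l s" "0 < f s * f s" using fs by (simp_all add: zero_less_mult_iff linorder_neq_iff disj_commute)
    note pos = order_tendstoD(1)[OF tendsto_mult_right[OF left[OF s], of "l s"] this(1)]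
      order_tendstoD(1)[OF tendsto_mult_right[OF right[OF s], of "f s"] this(2)]
    have "\<forall>\<^sub>F y in at_left s. 0 < f y * l s" by (rule pos)
    then obtain b where b: "b < s" "\<And>y. b < y \<Longrightarrow> y < s \<Longrightarrow> 0 < f y * l s"
      using eventually_at_left[of "s - 1" s] by auto
    have "\<forall>\<^sub>F y in at_right s. 0 < f y * f s" by (rule pos)
    then obtain c where c: "s < c" "\<And>z. s < z \<Longrightarrow> z < c \<Longrightarrow> 0 < f z * f s"
      using eventually_at_right[of s "s + 1"] by auto
    have "f y * f z < 0" if "s - min (s - b) (c - s) < y" "y < s" "s \<le> z" "z < s + min (s - b) (c - s)" for y z
    proof -
      have "0 < f y * l s" using that by (intro b) auto
      moreover have "0 < f z * f s"
        using c(2)[of z] that fs(2) by (cases "z = s") (auto simp: linorder_neq_iff mult_neg_neg)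
      ultimately show ?thesis
        using jump[OF s] by (auto simp: zero_less_mult_iff mult_less_0_iff)
    qed
    then show ?thesis using b(1) c(1) by (intro exI[of _ "min (s - b) (c - s)"]) auto
  qed
  then obtain d where d: "\<And>s. s \<in> F \<Longrightarrow> 0 < d s"
    "\<And>s y z. s \<in> F \<Longrightarrow> s - d s < y \<Longrightarrow> y < s \<Longrightarrow> s \<le> z \<Longrightarrow> z < s + d s \<Longrightarrow> f y * f z < 0" by metis
  \<comment> \<open>Radii of the neighbourhoods and mutual distances of the points, to be beaten by the mesh.\<close>
  let ?E = "d ` F \<union> (\<lambda>(s, s'). \<bar>s - s'\<bar>) ` {(s, s') \<in> F \<times> F. s \<noteq> s'}"
  have "finite {(s, s') \<in> F \<times> F. s \<noteq> s'}" by (rule finite_subset[of _ "F \<times> F"]) (auto simp: fin)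
  then have finE: "finite ?E" using fin by simp
  have posE: "0 < a" if "a \<in> ?E" for a using that d(1) by auto
  obtain e where e: "0 < e" "\<And>a. a \<in> ?E \<Longrightarrow> e \<le> a"
    by (rule finite_positive_lower_bound[OF finE posE]) auto
  have ed: "e \<le> d s" if "s \<in> F" for s using e(2) that by blast
  have sep: "e \<le> \<bar>s - s'\<bar>" if "s \<in> F" "s' \<in> F" "s \<noteq> s'" for s s'
    using that by (intro e(2)) force
  obtain N :: nat where N: "t / e < N" using reals_Archimedean2 by blast
  have "card F \<le> sign_changes f t n" if n: "Suc N \<le> n" for n
  proof -
    define h where "h = t / n"
    have n0: "0 < real n" using n by simp
    have h: "0 < h" using t n0 by (simp add: h_def)
    have "t / e < n" using N n by linarith
    then have he: "h < e" using e(1) n0 by (simp add: h_def field_simps)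
    \<comment> \<open>The cell containing \<open>s\<close>, with its right endpoint included: the path is evaluated strictly before \<open>s\<close> and at or after \<open>s\<close>.\<close>
    define j where "j = (\<lambda>s. nat (\<lceil>s / h\<rceil> - 1))"
    have j: "real (j s) * h < s" "s \<le> real (j s) * h + h" "j s < n" if "s \<in> F" for s
    proof -
      have s: "0 < s" "s \<le> t" using that F by auto
      have "0 < s / h" using s h by simp
      then have "1 \<le> \<lceil>s / h\<rceil>" by linarith
      then have eq: "real (j s) = of_int \<lceil>s / h\<rceil> - 1" by (simp add: j_def)
      have "real (j s) < s / h" "s / h \<le> real (j s) + 1" unfolding eq by linarith+
      then show 1: "real (j s) * h < s" and "s \<le> real (j s) * h + h"
        using h by (simp_all add: field_simps)
      have "real (j s) * h < real n * h" using 1 s n0 by (simp add: h_def)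
      then show "j s < n" using h by simp
    qed
    have "inj_on j F"
    proof (rule inj_onI, rule ccontr)
      fix s s' assume ss: "s \<in> F" "s' \<in> F" "j s = j s'" "s \<noteq> s'"
      then have "\<bar>s - s'\<bar> < h" using j[OF ss(1)] j[OF ss(2)] by auto
      then show False using sep[OF ss(1,2,4)] he by simp
    qed
    moreover have "j ` F \<subseteq> {i. i < n \<and> f (real i * h) * f (real i * h + h) < 0}"
    proof clarsimp
      fix s assume s: "s \<in> F"
      have "f (real (j s) * h) * f (real (j s) * h + h) < 0"
        using j[OF s] he ed[OF s] by (intro d(2)[OF s]) linarith+
      then show "j s < n \<and> f (real (j s) * h) * f (real (j s) * h + h) < 0" using j[OF s] by simp
    qed
    ultimately show ?thesis
      unfolding sign_changes_def h_def[symmetric] by (intro card_inj_on_le) auto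
  qed
  then show ?thesis unfolding eventually_sequentially by blast
qed

text \<open>At a reflection jump, \<open>\<langle>\<alpha>, X\<rangle>\<close> passes from its left limit to the negative of it, and this limit is not 0
  because the jump is genuine. The sum over an uncountable set of times is the
  supremum of its finite partial sums.\<close>

lemma jump_count_le_liminf:
  fixes X :: "real \<Rightarrow> 'w \<Rightarrow> 'a::euclidean_space"
  assumes cad: "cadlag (\<lambda>t. X t \<omega>)" and t: "0 < t" and \<alpha>: "\<alpha> \<noteq> 0"
  shows "jump_count X \<alpha> t \<omega>
     \<le> liminf (\<lambda>n. of_nat (sign_changes (\<lambda>t. \<alpha> \<bullet> X t \<omega>) t (Suc n)))"
proof -
  let ?L = "left_limit (\<lambda>u. X u \<omega>)"
  let ?J = "\<lambda>s. X s \<omega> = reflection \<alpha> (?L s) \<and> X s \<omega> \<noteq> ?L s"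
  have "(\<Sum>s\<in>F. of_bool (?J s)) \<le> liminf (\<lambda>n. of_nat (sign_changes (\<lambda>t. \<alpha> \<bullet> X t \<omega>) t (Suc n)) :: ennreal)"
    if F: "finite F" "F \<subseteq> {0<..t}" for F
  proof -
    have "\<forall>\<^sub>F n in sequentially. card {s \<in> F. ?J s} \<le> sign_changes (\<lambda>t. \<alpha> \<bullet> X t \<omega>) t n"
    proof (rule sign_changes_detect_jumps[where l = "\<lambda>s. \<alpha> \<bullet> ?L s"])
      fix s assume "s \<in> {s \<in> F. ?J s}"
      then have s: "0 < s" and J: "X s \<omega> = reflection \<alpha> (?L s)" "X s \<omega> \<noteq> ?L s" using F by auto
      obtain l where l: "((\<lambda>u. X u \<omega>) \<longlongrightarrow> l) (at_left s)"
        using cad s unfolding cadlag_def by blast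
      then have "?L s = l" unfolding left_limit_def by (intro tendsto_Lim) auto
      then show "((\<lambda>t. \<alpha> \<bullet> X t \<omega>) \<longlongrightarrow> \<alpha> \<bullet> ?L s) (at_left s)" using l by (intro tendsto_intros) simp
      show "((\<lambda>t. \<alpha> \<bullet> X t \<omega>) \<longlongrightarrow> \<alpha> \<bullet> X s \<omega>) (at_right s)"
        using cad s unfolding cadlag_def by (intro tendsto_intros) simp
      have "\<alpha> \<bullet> X s \<omega> = - (\<alpha> \<bullet> ?L s)"
        using \<alpha> unfolding J(1) by (simp add: reflection_def inner_diff_right power2_norm_eq_inner)
      moreover have "\<alpha> \<bullet> ?L s \<noteq> 0" using J by (auto simp: reflection_def)
      ultimately show "\<alpha> \<bullet> ?L s * (\<alpha> \<bullet> X s \<omega>) < 0"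
        by (simp add: zero_less_mult_iff linorder_neq_iff disj_commute)
    qed (use F t in auto)
    then have "\<forall>\<^sub>F n in sequentially. card {s \<in> F. ?J s} \<le> sign_changes (\<lambda>t. \<alpha> \<bullet> X t \<omega>) t (Suc n)"
      by (subst eventually_sequentially_Suc)
    then have "\<forall>\<^sub>F n in sequentially. (\<Sum>s\<in>F. of_bool (?J s))
        \<le> (of_nat (sign_changes (\<lambda>t. \<alpha> \<bullet> X t \<omega>) t (Suc n)) :: ennreal)"
    proof eventually_elim
      case (elim n)
      have "(\<Sum>s\<in>F. of_bool (?J s)) = (of_nat (card {s \<in> F. ?J s}) :: ennreal)"
        using F(1) by (simp add: of_bool_def sum.If_cases Int_def conj_commute)
      then show ?case using elim by simp
    qed
    then show ?thesis by (intro Liminf_bounded)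
  qed
  then show ?thesis
    unfolding jump_count_def by (subst nonneg_infsum_complete) (auto intro!: SUP_least)
qed

context dunkl_markov
begin

text \<open>The cell starting at time 0 contributes at most 1, and each of the other cells at most a constant times its
  length \<open>t / n\<close>.\<close>

lemma expected_sign_changes:
  assumes t: "0 < t" and n: "0 < n" and C: "\<And>s. 0 < s \<Longrightarrow> s \<le> t \<Longrightarrow> (\<integral>\<^sup>+\<omega>. ennreal (1 / (\<alpha> \<bullet> X s \<omega>)\<^sup>2) \<partial>M) \<le> C"
  shows "(\<lambda>\<omega>. of_nat (sign_changes (\<lambda>t. \<alpha> \<bullet> X t \<omega>) t n) :: ennreal) \<in> borel_measurable M"
    and "(\<integral>\<^sup>+\<omega>. of_nat (sign_changes (\<lambda>t. \<alpha> \<bullet> X t \<omega>) t n) \<partial>M) \<le> 1 + ennreal (2 * order * (norm \<alpha>)\<^sup>2 * t) * C"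
proof -
  define h where "h = t / n"
  have h: "0 < h" using t n by (simp add: h_def)
  define A where "A = (\<lambda>i::nat. {\<omega> \<in> space M. (\<alpha> \<bullet> X (real i * h) \<omega>) * (\<alpha> \<bullet> X (real i * h + h) \<omega>) < 0})"
  define c where "c = 2 * order * (norm \<alpha>)\<^sup>2"
  have "0 \<le> order" using k_nonneg' by (auto simp: dunkl_gamma_def intro!: add_nonneg_nonneg sum_nonneg)
  then have c: "0 \<le> c" by (simp add: c_def)
  have X[measurable]: "X (real i * h) \<in> borel_measurable M" "X (real i * h + h) \<in> borel_measurable M" for i :: nat
    using h by (auto intro!: measurable_process)
  have A[measurable]: "A i \<in> sets M" for i unfolding A_def by measurable
  have eq: "of_nat (sign_changes (\<lambda>t. \<alpha> \<bullet> X t \<omega>) t n) = (\<Sum>i<n. indicator (A i) \<omega> :: ennreal)" if "\<omega> \<in> space M" for \<omega>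
  proof -
    have "(\<Sum>i<n. indicator (A i) \<omega> :: ennreal) = of_nat (card ({..<n} \<inter> {i. \<omega> \<in> A i}))"
      by (simp add: indicator_def of_bool_def sum.If_cases)
    moreover have "{..<n} \<inter> {i. \<omega> \<in> A i} = {i. i < n \<and> (\<alpha> \<bullet> X (real i * h) \<omega>) * (\<alpha> \<bullet> X (real i * h + h) \<omega>) < 0}"
      using that by (auto simp: A_def)
    ultimately show ?thesis by (simp add: sign_changes_def h_def)
  qed
  show "(\<lambda>\<omega>. of_nat (sign_changes (\<lambda>t. \<alpha> \<bullet> X t \<omega>) t n) :: ennreal) \<in> borel_measurable M"
    by (subst measurable_cong[OF eq]) auto
  have step: "emeasure M (A i) \<le> ennreal (c * h) * C" if i: "i \<in> {1..<n}" for i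
  proof -
    have "real i * h \<le> real n * h" using i h by (intro mult_right_mono) auto
    moreover have "real n * h = t" using n by (simp add: h_def)
    ultimately have ih: "0 < real i * h" "real i * h \<le> t" using i h by auto
    have [measurable]: "X (real i * h) \<in> borel_measurable M" using X by simp
    have "emeasure M (A i) \<le> (\<integral>\<^sup>+\<omega>. ennreal (c * h / (\<alpha> \<bullet> X (real i * h) \<omega>)\<^sup>2) \<partial>M)"
      unfolding A_def c_def using ih h by (intro sign_change_probability) auto
    also have "\<dots> = (\<integral>\<^sup>+\<omega>. ennreal (c * h) * ennreal (1 / (\<alpha> \<bullet> X (real i * h) \<omega>)\<^sup>2) \<partial>M)"
      using c h by (intro nn_integral_cong) (simp add: ennreal_mult'[symmetric])
    also have "\<dots> = ennreal (c * h) * (\<integral>\<^sup>+\<omega>. ennreal (1 / (\<alpha> \<bullet> X (real i * h) \<omega>)\<^sup>2) \<partial>M)"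
      by (rule nn_integral_cmult) measurable
    also have "\<dots> \<le> ennreal (c * h) * C" by (intro mult_left_mono C ih) simp
    finally show ?thesis .
  qed
  have "(\<integral>\<^sup>+\<omega>. of_nat (sign_changes (\<lambda>t. \<alpha> \<bullet> X t \<omega>) t n) \<partial>M) = (\<integral>\<^sup>+\<omega>. (\<Sum>i<n. indicator (A i) \<omega>) \<partial>M)"
    by (intro nn_integral_cong eq)
  also have "\<dots> = (\<Sum>i<n. emeasure M (A i))" by (subst nn_integral_sum) auto
  also have "{..<n} = insert 0 {1..<n}" using n by auto
  also have "(\<Sum>i\<in>insert 0 {1..<n}. emeasure M (A i)) = emeasure M (A 0) + (\<Sum>i\<in>{1..<n}. emeasure M (A i))"
    by (subst sum.insert) auto
  also have "\<dots> \<le> 1 + (\<Sum>i\<in>{1..<n}. ennreal (c * h) * C)"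
    by (intro add_mono sum_mono step emeasure_le_1)
  also have "\<dots> \<le> 1 + of_nat n * (ennreal (c * h) * C)"
    by (auto intro!: add_left_mono mult_right_mono)
  also have "of_nat n * (ennreal (c * h) * C) = ennreal (c * t) * C"
    using c h n by (simp add: mult.assoc[symmetric] ennreal_of_nat_eq_real_of_nat ennreal_mult'[symmetric] h_def)
  finally show "(\<integral>\<^sup>+\<omega>. of_nat (sign_changes (\<lambda>t. \<alpha> \<bullet> X t \<omega>) t n) \<partial>M)
     \<le> 1 + ennreal (2 * order * (norm \<alpha>)\<^sup>2 * t) * C" by (simp add: c_def)
qed

lemma expected_jump_count_finite:
  assumes \<alpha>: "\<alpha> \<in> Rp" and half: "1 / 2 < k \<alpha>" and t: "0 < t"
    and away: "\<And>u. u \<in> mirror_images R x\<^sub>0 \<Longrightarrow> \<alpha> \<bullet> u \<noteq> 0"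
  shows "(\<integral>\<^sup>+\<omega>. jump_count X \<alpha> t \<omega> \<partial>M) < \<infinity>"
proof -
  have \<alpha>0: "\<alpha> \<noteq> 0" using \<alpha> Rp_subset root_nonzero by blast
  obtain C where C: "C < \<infinity>" "\<And>s. 0 < s \<Longrightarrow> s \<le> t \<Longrightarrow> (\<integral>\<^sup>+\<omega>. ennreal (1 / (\<alpha> \<bullet> X s \<omega>)\<^sup>2) \<partial>M) \<le> C"
    using inverse_square_bounded[OF \<alpha> half t away] by blast
  let ?S = "\<lambda>n \<omega>. of_nat (sign_changes (\<lambda>t. \<alpha> \<bullet> X t \<omega>) t (Suc n)) :: ennreal"
  have "(\<integral>\<^sup>+\<omega>. jump_count X \<alpha> t \<omega> \<partial>M) \<le> (\<integral>\<^sup>+\<omega>. liminf (\<lambda>n. ?S n \<omega>) \<partial>M)"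
  proof (rule nn_integral_mono)
    fix \<omega> assume \<omega>: "\<omega> \<in> space M"
    show "jump_count X \<alpha> t \<omega> \<le> liminf (\<lambda>n. ?S n \<omega>)"
      using jump_count_le_liminf[of X \<omega>, OF cadlag_path[OF \<omega>] t \<alpha>0]
      by simp
  qed
  also have "\<dots> \<le> liminf (\<lambda>n. \<integral>\<^sup>+\<omega>. ?S n \<omega> \<partial>M)"
    by (intro nn_integral_liminf expected_sign_changes(1)[OF t _ C(2)]) auto
  also have "\<dots> \<le> 1 + ennreal (2 * order * (norm \<alpha>)\<^sup>2 * t) * C"
    by (intro Liminf_le always_eventually allI expected_sign_changes(2)[OF t _ C(2)]) auto
  also have "\<dots> < \<infinity>" using C(1) by (simp add: ennreal_mult_less_top)
  finally show ?thesis .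
qed

end

theorem proposition3:
  fixes R S Ri :: "'a::euclidean_space set" and k :: "'a \<Rightarrow> real" and ki :: real
    and D :: "'a \<Rightarrow> 'a \<Rightarrow> real" and M :: "'w measure" and X :: "real \<Rightarrow> 'w \<Rightarrow> 'a"
    and \<alpha> x :: 'a and t :: real
  assumes "reduced_root_system R"
    and "simple_system R S"
    and "multiplicity_function R k"
    and "dunkl_kernel (positive_system R S) k D"
    and "prob_space M"
    and "dunkl_process (positive_system R S) k D M X"
    and "AE \<omega> in M. X 0 \<omega> = x"
    and "Ri \<in> weyl_orbit R ` R"
    and "\<forall>\<beta>\<in>Ri. k \<beta> = ki"
    and "ki > 1 / 2"
    and "\<alpha> \<in> Ri \<inter> positive_system R S"
    and "x \<notin> (\<Union>\<beta>\<in>Ri. hyperplane \<beta>)"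
    and "t \<ge> 0"
  shows "(\<integral>\<^sup>+ \<omega>. jump_count X \<alpha> t \<omega> \<partial>M) < \<infinity>"
proof (cases "t = 0")
  case True
  then show ?thesis by (simp add: jump_count_def)
next
  case False
  interpret prob_space M by fact
  interpret dunkl_markov R "positive_system R S" k D M X x
  proof
    show "finite R" "\<And>\<beta>. \<beta> \<in> R \<Longrightarrow> \<beta> \<noteq> 0" "\<And>\<beta>. \<beta> \<in> R \<Longrightarrow> reflection \<beta> ` R \<subseteq> R"
      using assms(1) by (auto simp: reduced_root_system_def)
    show "positive_system R S \<subseteq> R" by (auto simp: positive_system_def)
    show "\<And>\<beta>. \<beta> \<in> R \<Longrightarrow> 0 \<le> k \<beta>" using assms(3) by (simp add: multiplicity_function_def)
  qed fact+
  obtain \<rho> where Ri: "Ri = weyl_orbit R \<rho>" using assms(8) by blast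
  have closed: "reflection \<beta> ` Ri \<subseteq> Ri" if \<beta>: "\<beta> \<in> R" for \<beta>
  proof clarify
    fix \<gamma> assume "\<gamma> \<in> Ri"
    then obtain w where w: "w \<in> weyl_group R" "\<gamma> = w \<rho>" by (auto simp: Ri weyl_orbit_def)
    have "reflection \<beta> \<circ> w \<in> weyl_group R"
      by (intro weyl_group.weyl_comp weyl_group.weyl_reflection \<beta> w)
    then show "reflection \<beta> \<gamma> \<in> Ri" unfolding Ri weyl_orbit_def w(2) by (rule rev_image_eqI) simp
  qed
  show ?thesis
  proof (rule expected_jump_count_finite)
    fix u assume "u \<in> mirror_images R x"
    then obtain \<delta> where "\<delta> \<in> Ri" "\<alpha> \<bullet> u = \<delta> \<bullet> x"
      using inner_mirror_images[OF _ closed] assms(11) by blast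
    then show "\<alpha> \<bullet> u \<noteq> 0" using assms(12) by (auto simp: hyperplane_def)
  qed (use assms False in auto)
qed

end
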